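(* Let $p,q\in\mathbb{F}[t]$ be monic polynomials of degree $2$, set $\delta:=\operatorname{tr}p-\operatorname{tr}q$, and assume that both $p$ and $q$ are split over $\mathbb{F}$ with simple roots. Let $v$ be a $(p,q)$-exceptional endomorphism of a vector space $V$ over $\mathbb{F}$. The following conditions are equivalent: (i) $S(v)$ is a symplectic $(p,q)$-difference; (ii) $h(v)$ is a $(p,q)$-difference in $\operatorname{End}(V\times V^\star)$; (iii) $v$ is a $(p,q)$-difference in $\operatorname{End}(V)$; (iv) for every $x\in\operatorname{Root}(p)-\operatorname{Root}(q)$ such that $x\neq\delta-x$, the sequences $(n_k(v,x))_{k\geq1}$ and $(n_k(v,\delta-x))_{k\geq1}$ are $1$-intertwined.
   Context: $\mathbb{F}$ is an arbitrary field (characteristic $2$ allowed), with a fixed algebraic closure $\overline{\mathbb{F}}$; all vector spaces are finite-dimensional over $\mathbb{F}$. For a monic polynomial $r\in\mathbb{F}[t]$ of degree $n>0$, $\operatorname{tr}r$ is the opposite of the coefficient of $r$ on $t^{n-1}$, and $\operatorname{Root}(r)$ is the set of roots of $r$ in $\overline{\mathbb{F}}$; $\operatorname{Root}(p)-\operatorname{Root}(q):=\{x-y : x\in\operatorname{Root}(p),\,y\in\operatorname{Root}(q)\}$. An endomorphism is $(p,q)$-exceptional if all its eigenvalues in $\overline{\mathbb{F}}$ belong to $\operatorname{Root}(p)-\operatorname{Root}(q)$. An element $a$ of an $\mathbb{F}$-algebra $\mathcal{A}$ is a $(p,q)$-difference in $\mathcal{A}$ if $a=a_1-a_2$ for some $a_1,a_2\in\mathcal{A}$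 with $p(a_1)=0=q(a_2)$. For an endomorphism $u$ of $V$, $\lambda\in\mathbb{F}$ and $k\ge1$, $n_k(u,\lambda):=\dim\operatorname{Ker}(u-\lambda\operatorname{id}_V)^k-\dim\operatorname{Ker}(u-\lambda\operatorname{id}_V)^{k-1}$. For a positive integer $m$, two non-increasing sequences $(a_n)_{n\ge1}$, $(b_n)_{n\ge1}$ of non-negative integers are $m$-intertwined if $a_{n+m}\le b_n$ and $b_{n+m}\le a_n$ for all $n\ge1$. A symplectic form is a non-degenerate alternating bilinear form. Given a symplectic form $b$ on $V$, an endomorphism $u$ of $V$ is $b$-alternating if $b(x,u(x))=0$ for all $x\in V$. A symplectic pair $(b,u)$ consists of a symplectic form $b$ on a vector space and a $b$-alternating endomorphism $u$ of it. It is a symplectic $(p,q)$-difference if there are $b$-alternating endomorphisms $u_1,u_2$ with $u=u_1-u_2$, $p(u_1)=0$ and $q(u_2)=0$. For an endomorphism $v$ of $V$ with transpose $v^t:\varphi\mapsto\varphi\circ v$ on the dual space $V^\star$, put $h(v):=v\oplus v^t$ on $V\times V^\star$ and $S_V((x,\varphi),(y,\psi)):=\varphi(y)-\psi(x)$. The symplectic extension of $v$ is the symplectic pair $S(v):=(S_V,h(v))$. *)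

theory Defs
  imports
    "Jordan_Normal_Form.Char_Poly"
    "HOL-Algebra.Algebraic_Closure_Type"
    "HOL-Library.Function_Algebras"
    "HOL-Library.Product_Plus"
begin

section \<open>Polynomials\<close>

text \<open>The algebraic closure of the field \<open>'f\<close> is the library type \<open>'f alg_closure\<close>, with
  embedding \<^const>\<open>to_ac\<close>.\<close>

definition splits :: "'f::field poly \<Rightarrow> bool" where
  "splits r \<longleftrightarrow> (\<exists>as. r = Polynomial.smult (Polynomial.lead_coeff r) (\<Prod>a\<leftarrow>as. [:- a, 1:]))"

definition poly_tr :: "'f::field poly \<Rightarrow> 'f" where
  "poly_tr r = - Polynomial.coeff r (Polynomial.degree r - 1)"

definition Root :: "'f::field poly \<Rightarrow> 'f alg_closure set" where
  "Root r = {x. poly (map_poly to_ac r) x = 0}"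

definition Root_diff :: "'f::field poly \<Rightarrow> 'f poly \<Rightarrow> 'f alg_closure set" where
  "Root_diff p q = {x - y | x y. x \<in> Root p \<and> y \<in> Root q}"

section \<open>Endomorphisms of a subspace\<close>

text \<open>A vector space is given as a subspace \<open>W\<close> of an ambient vector space with scalar
  multiplication \<open>s\<close>; this is needed for the dual space, which is a proper subspace of a function
  space. Endomorphisms of \<open>W\<close> are functions on the ambient type that are only considered on \<open>W\<close>,
  their values outside of \<open>W\<close> being irrelevant.\<close>

definition endo_on :: "('f::field \<Rightarrow> 'w::ab_group_add \<Rightarrow> 'w) \<Rightarrow> 'w set \<Rightarrow> ('w \<Rightarrow> 'w) \<Rightarrow> bool" where
  "endo_on s W u \<longleftrightarrow>
     (\<forall>x\<in>W. u x \<in> W) \<and>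
     (\<forall>x\<in>W. \<forall>y\<in>W. u (x + y) = u x + u y) \<and>
     (\<forall>c. \<forall>x\<in>W. u (s c x) = s c (u x))"

definition poly_endo ::
    "('f::field \<Rightarrow> 'w::ab_group_add \<Rightarrow> 'w) \<Rightarrow> 'f poly \<Rightarrow> ('w \<Rightarrow> 'w) \<Rightarrow> 'w \<Rightarrow> 'w" where
  "poly_endo s r u x = (\<Sum>i\<le>Polynomial.degree r. s (Polynomial.coeff r i) ((u ^^ i) x))"

text \<open>\<open>u\<close> is a \<open>(p,q)\<close>-difference in \<open>End(W)\<close>.\<close>

definition pq_difference ::
    "('f::field \<Rightarrow> 'w::ab_group_add \<Rightarrow> 'w) \<Rightarrow> 'w set \<Rightarrow> 'f poly \<Rightarrow> 'f poly \<Rightarrow> ('w \<Rightarrow> 'w) \<Rightarrow> bool" where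
  "pq_difference s W p q u \<longleftrightarrow>
     (\<exists>u1 u2. endo_on s W u1 \<and> endo_on s W u2 \<and>
        (\<forall>x\<in>W. u x = u1 x - u2 x) \<and>
        (\<forall>x\<in>W. poly_endo s p u1 x = 0) \<and>
        (\<forall>x\<in>W. poly_endo s q u2 x = 0))"

text \<open>The dimension of \<open>ker (v - \<lambda> id)\<^sup>k\<close> is non-decreasing in \<open>k\<close> when the whole space is
  finite-dimensional, so that the subtraction does not truncate. Only \<open>k \<ge> 1\<close> is meaningful.\<close>

definition nk :: "('f::field \<Rightarrow> 'v::ab_group_add \<Rightarrow> 'v) \<Rightarrow> ('v \<Rightarrow> 'v) \<Rightarrow> 'f \<Rightarrow> nat \<Rightarrow> nat" where
  "nk s v l k =
     vector_space.dim s {x. ((\<lambda>y. v y - s l y) ^^ k) x = 0} -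
     vector_space.dim s {x. ((\<lambda>y. v y - s l y) ^^ (k - 1)) x = 0}"

text \<open>Sequences are indexed from \<open>1\<close>; the entry at \<open>0\<close> is ignored. The notion is meant for
  non-increasing sequences.\<close>

definition intertwined :: "nat \<Rightarrow> (nat \<Rightarrow> nat) \<Rightarrow> (nat \<Rightarrow> nat) \<Rightarrow> bool" where
  "intertwined m a b \<longleftrightarrow> (\<forall>n\<ge>1. a (n + m) \<le> b n \<and> b (n + m) \<le> a n)"

section \<open>Eigenvalues in the algebraic closure\<close>

definition basis_list :: "('f::field \<Rightarrow> 'v::ab_group_add \<Rightarrow> 'v) \<Rightarrow> 'v list \<Rightarrow> bool" where
  "basis_list s bs \<longleftrightarrow>
     distinct bs \<and> \<not> module.dependent s (set bs) \<and> module.span s (set bs) = UNIV"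

definition matrix_in_basis ::
    "('f::field \<Rightarrow> 'v::ab_group_add \<Rightarrow> 'v) \<Rightarrow> 'v list \<Rightarrow> ('v \<Rightarrow> 'v) \<Rightarrow> 'f mat" where
  "matrix_in_basis s bs v =
     mat (length bs) (length bs)
       (\<lambda>(i, j). module.representation s (set bs) (v (bs ! j)) (bs ! i))"

text \<open>The eigenvalues of \<open>v\<close> in the algebraic closure are those of its scalar extension, i.e.\ of
  its matrix regarded as a matrix over the closure. They do not depend on the basis.\<close>

definition ac_eigenvalue ::
    "('f::field \<Rightarrow> 'v::ab_group_add \<Rightarrow> 'v) \<Rightarrow> ('v \<Rightarrow> 'v) \<Rightarrow> 'f alg_closure \<Rightarrow> bool" where
  "ac_eigenvalue s v l \<longleftrightarrow>
     (\<exists>bs. basis_list s bs \<and> eigenvalue (map_mat to_ac (matrix_in_basis s bs v)) l)"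

definition pq_exceptional ::
    "('f::field \<Rightarrow> 'v::ab_group_add \<Rightarrow> 'v) \<Rightarrow> 'f poly \<Rightarrow> 'f poly \<Rightarrow> ('v \<Rightarrow> 'v) \<Rightarrow> bool" where
  "pq_exceptional s p q v \<longleftrightarrow> (\<forall>l. ac_eigenvalue s v l \<longrightarrow> l \<in> Root_diff p q)"

section \<open>Symplectic pairs\<close>

definition bilinear_on ::
    "('f::field \<Rightarrow> 'w::ab_group_add \<Rightarrow> 'w) \<Rightarrow> 'w set \<Rightarrow> ('w \<Rightarrow> 'w \<Rightarrow> 'f) \<Rightarrow> bool" where
  "bilinear_on s W b \<longleftrightarrow>
     (\<forall>x\<in>W. \<forall>y\<in>W. \<forall>z\<in>W. b (x + y) z = b x z + b y z \<and> b z (x + y) = b z x + b z y) \<and>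
     (\<forall>c. \<forall>x\<in>W. \<forall>y\<in>W. b (s c x) y = c * b x y \<and> b x (s c y) = c * b x y)"

definition symplectic_form ::
    "('f::field \<Rightarrow> 'w::ab_group_add \<Rightarrow> 'w) \<Rightarrow> 'w set \<Rightarrow> ('w \<Rightarrow> 'w \<Rightarrow> 'f) \<Rightarrow> bool" where
  "symplectic_form s W b \<longleftrightarrow>
     bilinear_on s W b \<and> (\<forall>x\<in>W. b x x = 0) \<and> (\<forall>x\<in>W. (\<forall>y\<in>W. b x y = 0) \<longrightarrow> x = 0)"

definition b_alternating ::
    "('f::field \<Rightarrow> 'w::ab_group_add \<Rightarrow> 'w) \<Rightarrow> 'w set \<Rightarrow> ('w \<Rightarrow> 'w \<Rightarrow> 'f) \<Rightarrow> ('w \<Rightarrow> 'w) \<Rightarrow> bool" where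
  "b_alternating s W b u \<longleftrightarrow> endo_on s W u \<and> (\<forall>x\<in>W. b x (u x) = 0)"

definition symplectic_pair ::
    "('f::field \<Rightarrow> 'w::ab_group_add \<Rightarrow> 'w) \<Rightarrow> 'w set \<Rightarrow> ('w \<Rightarrow> 'w \<Rightarrow> 'f) \<times> ('w \<Rightarrow> 'w) \<Rightarrow> bool" where
  "symplectic_pair s W = (\<lambda>(b, u). symplectic_form s W b \<and> b_alternating s W b u)"

definition symplectic_pq_difference ::
    "('f::field \<Rightarrow> 'w::ab_group_add \<Rightarrow> 'w) \<Rightarrow> 'w set \<Rightarrow> 'f poly \<Rightarrow> 'f poly \<Rightarrow>
     ('w \<Rightarrow> 'w \<Rightarrow> 'f) \<times> ('w \<Rightarrow> 'w) \<Rightarrow> bool" where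
  "symplectic_pq_difference s W p q = (\<lambda>(b, u).
     symplectic_pair s W (b, u) \<and>
     (\<exists>u1 u2. b_alternating s W b u1 \<and> b_alternating s W b u2 \<and>
        (\<forall>x\<in>W. u x = u1 x - u2 x) \<and>
        (\<forall>x\<in>W. poly_endo s p u1 x = 0) \<and>
        (\<forall>x\<in>W. poly_endo s q u2 x = 0)))"

section \<open>The symplectic extension of an endomorphism\<close>

definition dual_space :: "('f::field \<Rightarrow> 'v::ab_group_add \<Rightarrow> 'v) \<Rightarrow> ('v \<Rightarrow> 'f) set" where
  "dual_space s = {\<phi>. Vector_Spaces.linear s (*) \<phi>}"

definition ext_scale ::
    "('f::field \<Rightarrow> 'v::ab_group_add \<Rightarrow> 'v) \<Rightarrow> 'f \<Rightarrow> 'v \<times> ('v \<Rightarrow> 'f) \<Rightarrow> 'v \<times> ('v \<Rightarrow> 'f)" where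
  "ext_scale s c = map_prod (s c) (\<lambda>\<phi> y. c * \<phi> y)"

definition ext_space :: "('f::field \<Rightarrow> 'v::ab_group_add \<Rightarrow> 'v) \<Rightarrow> ('v \<times> ('v \<Rightarrow> 'f)) set" where
  "ext_space s = UNIV \<times> dual_space s"

definition h_ext :: "('v \<Rightarrow> 'v) \<Rightarrow> 'v \<times> ('v \<Rightarrow> 'f) \<Rightarrow> 'v \<times> ('v \<Rightarrow> 'f)" where
  "h_ext v = map_prod v (\<lambda>\<phi>. \<phi> \<circ> v)"

definition S_form :: "'v \<times> ('v \<Rightarrow> 'f::field) \<Rightarrow> 'v \<times> ('v \<Rightarrow> 'f) \<Rightarrow> 'f" where
  "S_form = (\<lambda>(x, \<phi>) (y, \<psi>). \<phi> y - \<psi> x)"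

definition S_ext ::
    "('v \<Rightarrow> 'v) \<Rightarrow>
     ('v \<times> ('v \<Rightarrow> 'f::field) \<Rightarrow> 'v \<times> ('v \<Rightarrow> 'f) \<Rightarrow> 'f) \<times> ('v \<times> ('v \<Rightarrow> 'f) \<Rightarrow> 'v \<times> ('v \<Rightarrow> 'f))" where
  "S_ext v = (S_form, h_ext v)"

section \<open>Consistency of the definitions\<close>

lemma linear_iff:
  fixes s :: "'f::field \<Rightarrow> 'v::ab_group_add \<Rightarrow> 'v" and t :: "'f \<Rightarrow> 'w::ab_group_add \<Rightarrow> 'w"
  assumes "vector_space s" "vector_space t"
  shows "Vector_Spaces.linear s t f \<longleftrightarrow>
    (\<forall>x y. f (x + y) = f x + f y) \<and> (\<forall>c x. f (s c x) = t c (f x))"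
  using assms
  by (auto simp: Vector_Spaces.linear_def module_hom_def module_hom_axioms_def
      module_iff_vector_space)

lemma endo_on_UNIV_iff:
  assumes "vector_space s"
  shows "endo_on s UNIV u \<longleftrightarrow> Vector_Spaces.linear s s u"
  using linear_iff[OF assms assms] by (auto simp: endo_on_def)

lemma vector_space_field: "vector_space ((*) :: 'f::field \<Rightarrow> 'f \<Rightarrow> 'f)"
  by unfold_locales (auto simp: algebra_simps)

lemma mem_dual_space_iff:
  assumes "vector_space s"
  shows "\<phi> \<in> dual_space s \<longleftrightarrow>
    (\<forall>x y. \<phi> (x + y) = \<phi> x + \<phi> y) \<and> (\<forall>c x. \<phi> (s c x) = c * \<phi> x)"
  using linear_iff[OF assms vector_space_field] by (auto simp: dual_space_def)

lemma vector_space_ext_scale: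
  assumes "vector_space s"
  shows "vector_space (ext_scale s)"
proof -
  interpret vector_space s by fact
  show ?thesis
    by unfold_locales
      (auto simp: ext_scale_def plus_fun_def algebra_simps scale_right_distrib scale_left_distrib)
qed

lemma subspace_ext_space:
  assumes "vector_space s"
  shows "module.subspace (ext_scale s) (ext_space s)"
proof -
  interpret e: vector_space "ext_scale s" by (rule vector_space_ext_scale) fact
  show ?thesis
    unfolding e.subspace_def
    by (auto simp: ext_scale_def ext_space_def mem_dual_space_iff[OF assms] zero_prod_def
        algebra_simps)
qed

lemma symplectic_form_S_form:
  assumes "vector_space s"
  shows "symplectic_form (ext_scale s) (ext_space s) S_form"
proof -
  interpret vector_space s by fact
  interpret p: vector_space_pair s "(*) :: 'a \<Rightarrow> 'a \<Rightarrow> 'a"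
    using assms vector_space_field by (rule vector_space_pair.intro)
  have "x = 0" if "\<forall>\<psi>\<in>dual_space s. \<psi> x = 0" for x
  proof (rule ccontr)
    assume "x \<noteq> 0"
    hence "independent {x}" by simp
    then obtain g where "Vector_Spaces.linear s (*) g" "g x = 1"
      using p.linear_independent_extend[of "{x}" "\<lambda>_. 1"] by auto
    thus False using that by (auto simp: dual_space_def)
  qed
  moreover have "0 \<in> dual_space s"
    by (simp add: mem_dual_space_iff[OF assms])
  ultimately have "x = 0 \<and> \<phi> = 0"
    if "\<forall>y. \<forall>\<psi>\<in>dual_space s. \<phi> y - \<psi> x = 0" for x \<phi>
  proof -
    have "\<phi> y = 0" for y using that \<open>0 \<in> dual_space s\<close> by force
    moreover from this have "x = 0"
      using that \<open>\<And>x. \<forall>\<psi>\<in>dual_space s. \<psi> x = 0 \<Longrightarrow> x = 0\<close> by force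
    ultimately show ?thesis by auto
  qed
  note nondegenerate = this
  have "w = 0" if "w \<in> ext_space s" "\<forall>z\<in>ext_space s. S_form w z = 0" for w
  proof -
    obtain x \<phi> where w: "w = (x, \<phi>)" by (cases w)
    have "\<phi> y - \<psi> x = 0" if "\<psi> \<in> dual_space s" for y \<psi>
      using that \<open>\<forall>z\<in>ext_space s. S_form w z = 0\<close>[rule_format, of "(y, \<psi>)"]
      by (simp add: w S_form_def ext_space_def)
    hence "\<forall>y. \<forall>\<psi>\<in>dual_space s. \<phi> y - \<psi> x = 0" by simp
    hence "x = 0 \<and> \<phi> = 0" by (rule nondegenerate)
    thus "w = 0" by (simp add: w zero_prod_def)
  qed
  moreover have "bilinear_on (ext_scale s) (ext_space s) S_form"
    unfolding bilinear_on_def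
    by (auto simp: S_form_def ext_space_def ext_scale_def mem_dual_space_iff[OF assms]
        right_diff_distrib)
  moreover have "\<forall>w\<in>ext_space s. S_form w w = 0"
    by (auto simp: S_form_def)
  ultimately show ?thesis
    by (simp add: symplectic_form_def)
qed

lemma symplectic_pair_S_ext:
  assumes "vector_space s" "Vector_Spaces.linear s s v"
  shows "symplectic_pair (ext_scale s) (ext_space s) (S_ext v)"
  using symplectic_form_S_form[OF assms(1)] assms(2)
  unfolding linear_iff[OF assms(1) assms(1)]
  by (auto simp: symplectic_pair_def b_alternating_def endo_on_def S_ext_def S_form_def h_ext_def
      ext_space_def ext_scale_def mem_dual_space_iff[OF assms(1)] fun_eq_iff)

text \<open>If \<open>r\<close> splits, its roots in the closure lie in the base field. Hence the elements of
  \<open>Root p - Root q\<close> are exactly the elements of the form \<open>to_ac x\<close> belonging to it.\<close>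

lemma Root_subset_if_splits:
  assumes "splits r" "r \<noteq> 0"
  shows "Root r \<subseteq> range to_ac"
proof -
  from assms(1) obtain as where
    r: "r = Polynomial.smult (Polynomial.lead_coeff r) (\<Prod>a\<leftarrow>as. [:- a, 1:])"
    unfolding splits_def by blast
  interpret to_ac: field_hom to_ac by unfold_locales auto
  interpret m: map_poly_comm_ring_hom to_ac by unfold_locales
  have "map_poly to_ac (\<Prod>a\<leftarrow>as. [:- a, 1:]) = (\<Prod>a\<leftarrow>as. [:- to_ac a, 1:])"
    by (induction as) (simp_all add: m.hom_mult map_poly_pCons del: mult_pCons_left mult_pCons_right)
  hence "map_poly to_ac r =
      Polynomial.smult (to_ac (Polynomial.lead_coeff r)) (\<Prod>a\<leftarrow>as. [:- to_ac a, 1:])"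
    by (subst r) (simp add: hom_distribs)
  hence "poly (map_poly to_ac r) x = 0 \<Longrightarrow> x \<in> to_ac ` set as" for x
    using assms(2) by (auto simp: poly_prod_list prod_list_zero_iff)
  thus ?thesis by (auto simp: Root_def)
qed

lemma Root_diff_subset_if_splits:
  assumes "splits p" "p \<noteq> 0" "splits q" "q \<noteq> 0"
  shows "Root_diff p q \<subseteq> range to_ac"
proof
  fix z assume "z \<in> Root_diff p q"
  then obtain x y where z: "z = x - y" "x \<in> Root p" "y \<in> Root q" by (auto simp: Root_diff_def)
  obtain a b where "x = to_ac a" "y = to_ac b"
    using z Root_subset_if_splits assms by blast
  with z have "z = to_ac (a - b)" by simp
  thus "z \<in> range to_ac" by blast
qed

end

(*
  Write x = a - b, y = a' - b' where a, a' are the roots of p and b, b' those of q, so that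
  y = delta - x; the other differences of roots form a second pair of this kind.

  If u = A - B is a (p,q)-difference, the commutator f of A and B satisfies f u = (delta - u) f, so it
  exchanges the generalized eigenspaces of u for x and y, and f^2 is a polynomial in u with simple
  roots at x and y when x and y differ. On these eigenspaces the powers of f thus refine the powers of u - x
  and u - y, and f maps the kernels of f^(j+1) on one side into those of f^j, which makes the
  sequences n_k(u,x) and n_k(u,y) 1-intertwined. Applied to u = h(v), whose numbers n_k are
  twice those of v because v and its transpose have equal kernel dimensions, this gives (ii) => (iv).

  Conversely, if the sequences are 1-intertwined, the Jordan blocks for x and y can be paired so that
  paired sizes differ by at most 1, a missing block counting as a block of size 0. By the Chinese
  remainder theorem each pair spans a cyclic module, which has a basis in which v is bidiagonal with
  alternating diagonal entries x and y, and such a matrix is visibly a (p,q)-difference. Finally h(v1) and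
  h(v2) are alternating whenever v = v1 - v2, hence (iii) => (i).
*)
theory Submission
  imports Defs "HOL-Analysis.Product_Vector"
begin

section \<open>Linear algebra\<close>

text \<open>The simplicity of the roots of \<open>p\<close> and of \<open>q\<close> keeps the two
  pairs of eigenvalues disjoint: differences taken from different pairs share exactly one root. In
  the necessity part this makes the cofactor of \<open>(t - x) * (t - y)\<close> in
  \<open>f^2\<close> invertible on the generalized eigenspaces for \<open>x\<close> and
  \<open>y\<close>; in the sufficiency part it lets the two pairs be merged independently. A pair
  with \<open>x = y\<close> imposes no condition, since the diagonal of a Jordan block of any size
  is then already alternating. Exceptionality enters in (iv) => (iii): it makes the characteristic
  polynomial a product of linear factors over the base field, with all roots in the two pairs.

  The formal obstacle is the dual space, which is only a subset of a function type, while the module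
  arguments run on a whole type. A coordinate pairing identifies \<open>V\<close> with its dual and
  turns the transpose into an endomorphism of \<open>V\<close>, so that the necessity argument can
  be run on \<open>V \<times> V\<close>.

  Coprimality is expressed by Bezout identities, because these pass to powers and directly provide
  the combinations that act on vectors.\<close>

definition comaximal :: "'a::comm_ring_1 \<Rightarrow> 'a \<Rightarrow> bool" where
  "comaximal x y \<longleftrightarrow> (\<exists>s t. s * x + t * y = 1)"

lemma comaximal_commute: "comaximal x y \<longleftrightarrow> comaximal y x"
  unfolding comaximal_def by (metis add.commute)

lemma comaximal_mult_right:
  assumes "comaximal x y" "comaximal x z"
  shows "comaximal x (y * z)"
proof -
  obtain s t s' t' where "s * x + t * y = 1" "s' * x + t' * z = 1"
    using assms by (auto simp: comaximal_def)
  then have "(s * x + t * y) * (s' * x + t' * z) = 1" by simp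
  then have "(s * (s' * x + t' * z) + t * y * s') * x + (t * t') * (y * z) = 1"
    by (simp add: algebra_simps)
  then show ?thesis unfolding comaximal_def by blast
qed

lemma comaximal_power_right: "comaximal x y \<Longrightarrow> comaximal x (y ^ n)"
proof (induction n)
  case 0
  show ?case unfolding comaximal_def by (intro exI[of _ 0] exI[of _ 1]) simp
qed (simp add: comaximal_mult_right)

lemma comaximal_powers: "comaximal x y \<Longrightarrow> comaximal (x ^ m) (y ^ n)"
  by (metis comaximal_commute comaximal_power_right)

lemma comaximal_dvd_mult:
  assumes "comaximal x y" "x dvd y * z"
  shows "x dvd z"
proof -
  obtain s t where "s * x + t * y = 1" using assms(1) by (auto simp: comaximal_def)
  then have "z = x * (s * z) + t * (y * z)"
    by (metis (no_types, opaque_lifting) distrib_right mult.assoc mult.commute mult_1)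
  then show ?thesis using assms(2) by (metis dvd_add dvd_mult dvd_triv_left)
qed

lemma comaximal_linear:
  assumes "(a :: 'a::field) \<noteq> b"
  shows "comaximal [:- a, 1:] [:- b, 1:]"
proof -
  define c where "c = inverse (b - a)"
  have "c * b - c * a = 1" using assms by (simp add: c_def flip: right_diff_distrib)
  then have "[:c:] * [:- a, 1:] + [:- c:] * [:- b, 1:] = 1" by (simp add: one_pCons mult.commute)
  then show ?thesis unfolding comaximal_def by blast
qed

lemma comaximal_mult_dvd:
  assumes "comaximal x y" "x dvd z" "y dvd z"
  shows "x * y dvd z"
proof -
  obtain s t where st: "s * x + t * y = 1" using assms(1) by (auto simp: comaximal_def)
  have "z = (s * x + t * y) * z" by (simp add: st)
  also have "\<dots> = s * (x * z) + t * (y * z)" by (simp add: algebra_simps)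
  finally have "z = s * (x * z) + t * (y * z)" .
  moreover have "x * y dvd s * (x * z)" using assms(3) by (simp add: mult_dvd_mono)
  moreover have "x * y dvd t * (y * z)"
    using assms(2) mult_dvd_mono[of x z y y] by (simp add: mult.commute)
  ultimately show ?thesis by (metis dvd_add)
qed

section \<open>Dimension counts and adjoint kernels\<close>

context finite_dimensional_vector_space
begin

text \<open>\<open>independent\<close> speaks of the image set, which forgets repetitions, whereas
  the hypothesis is about the indexed family. A repetition \<open>e i = e j\<close> would be the
  nontrivial relation \<open>e i - e j = 0\<close>.\<close>

lemma independent_family:
  assumes "finite J" and indep: "\<And>c i. (\<Sum>i\<in>J. scale (c i) (e i)) = 0 \<Longrightarrow> i \<in> J \<Longrightarrow> c i = 0"
  shows "inj_on e J" "independent (e ` J)"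
proof -
  show inj: "inj_on e J"
  proof (rule inj_onI)
    fix i j assume ij: "i \<in> J" "j \<in> J" "e i = e j"
    show "i = j"
    proof (rule ccontr)
      assume "i \<noteq> j"
      let ?c = "\<lambda>k. (if k = i then 1 else 0) - (if k = j then 1 else 0) :: 'a"
      have "(\<Sum>k\<in>J. scale (?c k) (e k)) =
          (\<Sum>k\<in>J. if k = i then e k else 0) - (\<Sum>k\<in>J. if k = j then e k else 0)"
        by (simp add: scale_left_diff_distrib sum_subtractf if_distrib[of "\<lambda>c. scale c _"] cong: if_cong)
      also have "\<dots> = 0" using ij \<open>finite J\<close> by simp
      finally show False using indep[of ?c i] ij(1) \<open>i \<noteq> j\<close> by simp
    qed
  qed
  show "independent (e ` J)"
  proof (rule independent_if_scalars_zero)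
    fix f y assume "(\<Sum>y\<in>e ` J. scale (f y) y) = 0" "y \<in> e ` J"
    then show "f y = 0" using indep[of "\<lambda>i. f (e i)"] inj by (auto simp: sum.reindex)
  qed (use assms in simp)
qed

text \<open>The vectors \<open>e i\<close> represent a basis of the quotient of \<open>T\<close> by
  \<open>S\<close>. Independence and generation are both stated modulo \<open>S\<close>, so that no
  quotient space has to be formed: the span of the \<open>e i\<close> is a complement of
  \<open>S\<close> in \<open>T\<close>.\<close>

lemma dim_eq_add_card:
  assumes "subspace S" "subspace T" "S \<subseteq> T" "finite J" "e ` J \<subseteq> T"
    and indep: "\<And>c i. (\<Sum>i\<in>J. scale (c i) (e i)) \<in> S \<Longrightarrow> i \<in> J \<Longrightarrow> c i = 0"
    and gen: "\<And>x. x \<in> T \<Longrightarrow> \<exists>c. x - (\<Sum>i\<in>J. scale (c i) (e i)) \<in> S"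
  shows "dim T = dim S + card J"
proof -
  have "0 \<in> S" using assms(1) by (rule subspace_0)
  have fam: "inj_on e J" "independent (e ` J)"
    by (rule independent_family[OF \<open>finite J\<close>]; use indep \<open>0 \<in> S\<close> in force)+
  note inj = fam(1) and ind = fam(2)
  have sum_image: "(\<Sum>y\<in>e ` J. scale (f y) y) = (\<Sum>i\<in>J. scale (f (e i)) (e i))" for f
    using inj by (simp add: sum.reindex)
  have "S \<inter> span (e ` J) = {0}"
  proof (intro equalityI subsetI)
    fix x assume "x \<in> S \<inter> span (e ` J)"
    then obtain f where "x = (\<Sum>i\<in>J. scale (f (e i)) (e i))" "x \<in> S"
      using assms(4) by (auto simp: span_finite sum_image)
    with indep[of "\<lambda>i. f (e i)"] show "x \<in> {0}" by simp
  qed (use \<open>0 \<in> S\<close> span_zero in auto)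
  moreover have "{x + y |x y. x \<in> S \<and> y \<in> span (e ` J)} = T"
  proof (intro equalityI subsetI)
    fix x assume "x \<in> {x + y |x y. x \<in> S \<and> y \<in> span (e ` J)}"
    moreover have "span (e ` J) \<subseteq> T" by (rule span_minimal) (use assms in auto)
    ultimately show "x \<in> T" using assms(2,3) subspace_add by blast
  next
    fix x assume "x \<in> T"
    then obtain c where "x - (\<Sum>i\<in>J. scale (c i) (e i)) \<in> S" using gen by blast
    moreover have "(\<Sum>i\<in>J. scale (c i) (e i)) \<in> span (e ` J)"
      by (intro span_sum span_scale span_base) auto
    moreover have "x = (x - (\<Sum>i\<in>J. scale (c i) (e i))) + (\<Sum>i\<in>J. scale (c i) (e i))" by simp
    ultimately show "x \<in> {x + y |x y. x \<in> S \<and> y \<in> span (e ` J)}" by blast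
  qed
  ultimately have "dim T + dim {0} = dim S + dim (span (e ` J))"
    using dim_sums_Int[OF assms(1) subspace_span[of "e ` J"]] by simp
  then show ?thesis
    using dim_eq_card_independent[OF ind] card_image[OF inj] by simp
qed

text \<open>Rank-nullity on a subspace: preimages in \<open>S\<close> of a basis of the image
  represent a basis of \<open>S\<close> modulo the kernel.\<close>

lemma dim_image_add_dim_kernel:
  assumes f: "Vector_Spaces.linear scale scale f" and S: "subspace S"
  shows "dim S = dim {x \<in> S. f x = 0} + dim (f ` S)"
proof -
  interpret f: Vector_Spaces.linear scale scale f by fact
  have sub: "subspace {x \<in> S. f x = 0}"
    using S by (auto simp: subspace_def f.add f.scale f.zero)
  obtain B where B: "B \<subseteq> f ` S" "independent B" "f ` S \<subseteq> span B" "card B = dim (f ` S)"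
    by (rule basis_exists[of "f ` S"])
  have "finite B" using B(2) by (rule finiteI_independent)
  have "\<exists>x\<in>S. f x = b" if "b \<in> B" for b using that B(1) by auto
  then obtain e where e: "\<And>b. b \<in> B \<Longrightarrow> e b \<in> S" "\<And>b. b \<in> B \<Longrightarrow> f (e b) = b" by metis
  have f_sum: "f (\<Sum>b\<in>B. scale (c b) (e b)) = (\<Sum>b\<in>B. scale (c b) b)" for c
    by (simp add: f.sum f.scale e(2))
  have "dim S = dim {x \<in> S. f x = 0} + card B"
  proof (rule dim_eq_add_card[OF sub S _ \<open>finite B\<close>])
    show "c b = 0" if "(\<Sum>b\<in>B. scale (c b) (e b)) \<in> {x \<in> S. f x = 0}" "b \<in> B" for c b
      using that f_sum B(2) \<open>finite B\<close> independentD[of B B c b] by auto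
    show "\<exists>c. x - (\<Sum>b\<in>B. scale (c b) (e b)) \<in> {x \<in> S. f x = 0}" if "x \<in> S" for x
    proof -
      have "f x \<in> span B" using that B(3) by blast
      then obtain c where "f x = (\<Sum>b\<in>B. scale (c b) b)" using \<open>finite B\<close> by (auto simp: span_finite)
      moreover have "x - (\<Sum>b\<in>B. scale (c b) (e b)) \<in> S"
        by (intro subspace_diff subspace_sum subspace_scale S that e(1))
      ultimately show ?thesis by (intro exI[of _ c]) (simp add: f.diff f_sum)
    qed
  qed (use e(1) in auto)
  then show ?thesis using B(4) by simp
qed

text \<open>The dot product of coordinates with respect to \<open>Basis\<close>. It is symmetric and
  nondegenerate, hence identifies the space with its dual.\<close>

definition basis_pairing :: "'b \<Rightarrow> 'b \<Rightarrow> 'a" where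
  "basis_pairing x y = (\<Sum>b\<in>Basis. representation Basis x b * representation Basis y b)"

lemma representation_Basis_linear:
  "representation Basis (x + y) b = representation Basis x b + representation Basis y b"
  "representation Basis (scale c x) b = c * representation Basis x b"
  by (simp_all add: representation_add representation_scale independent_Basis span_Basis)

lemma basis_pairing_linear:
  "basis_pairing (x + y) z = basis_pairing x z + basis_pairing y z"
  "basis_pairing (scale c x) z = c * basis_pairing x z"
  "basis_pairing z (x + y) = basis_pairing z x + basis_pairing z y"
  "basis_pairing z (scale c x) = c * basis_pairing z x"
  by (simp_all add: basis_pairing_def representation_Basis_linear sum.distrib sum_distrib_left
      algebra_simps)

lemma basis_pairing_zero [simp]: "basis_pairing 0 x = 0" "basis_pairing x 0 = 0"
  by (simp_all add: basis_pairing_def representation_zero)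

lemma basis_pairing_commute: "basis_pairing x y = basis_pairing y x"
  by (simp add: basis_pairing_def mult.commute)

lemma linear_basis_pairing: "Vector_Spaces.linear scale (*) (basis_pairing x)"
  by (simp add: Defs.linear_iff[OF vector_space_axioms vector_space_field] basis_pairing_linear)

lemma basis_pairing_Basis:
  assumes "b \<in> Basis"
  shows "basis_pairing x b = representation Basis x b"
  using assms finite_Basis
  by (simp add: basis_pairing_def representation_basis[OF independent_Basis]
      if_distrib[of "\<lambda>c. _ * c"] eq_commute[of b] cong: if_cong)

lemma sum_representation_Basis: "(\<Sum>b\<in>Basis. scale (representation Basis x b) b) = x"
  by (rule sum_representation_eq) (simp_all add: independent_Basis span_Basis finite_Basis)

lemma basis_pairing_nondegenerate:
  assumes "\<And>y. basis_pairing x y = 0"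
  shows "x = 0"
  using sum_representation_Basis[of x] assms by (simp flip: basis_pairing_Basis)

lemma linear_functional_eq_basis_pairing:
  assumes "Vector_Spaces.linear scale (*) \<phi>"
  shows "\<phi> = basis_pairing (\<Sum>b\<in>Basis. scale (\<phi> b) b)"
proof
  interpret \<phi>: Vector_Spaces.linear scale "(*)" \<phi> by fact
  fix y
  have rep: "basis_pairing b y = representation Basis y b" if "b \<in> Basis" for b
    using basis_pairing_Basis[OF that, of y] basis_pairing_commute[of b y] by simp
  have "(\<lambda>x. basis_pairing x y) = basis_pairing y" by (rule ext) (rule basis_pairing_commute)
  then interpret lin: Vector_Spaces.linear scale "(*)" "\<lambda>x. basis_pairing x y"
    using linear_basis_pairing[of y] by simp
  have "\<phi> y = \<phi> (\<Sum>b\<in>Basis. scale (representation Basis y b) b)"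
    by (simp add: sum_representation_Basis)
  also have "\<dots> = (\<Sum>b\<in>Basis. representation Basis y b * \<phi> b)"
    by (simp only: \<phi>.sum \<phi>.scale)
  also have "\<dots> = (\<Sum>b\<in>Basis. \<phi> b * basis_pairing b y)"
    by (rule sum.cong) (simp_all add: rep mult.commute)
  also have "\<dots> = basis_pairing (\<Sum>b\<in>Basis. scale (\<phi> b) b) y"
    by (simp only: lin.sum lin.scale)
  finally show "\<phi> y = basis_pairing (\<Sum>b\<in>Basis. scale (\<phi> b) b) y" .
qed

text \<open>A vector of the kernel of \<open>T'\<close> pairs to zero with the range of
  \<open>T\<close>, so it is determined by its pairings with the vectors \<open>C\<close> that
  complete a basis of that range to a basis of the space. The map \<open>m\<close> records these
  pairings, and \<open>C\<close> has as many elements as the kernel of \<open>T\<close> has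
  dimensions.\<close>

lemma dim_kernel_adjoint_le:
  assumes T: "Vector_Spaces.linear scale scale T" and T': "Vector_Spaces.linear scale scale T'"
    and adj: "\<And>x y. basis_pairing (T' x) y = basis_pairing x (T y)"
  shows "dim {x. T' x = 0} \<le> dim {x. T x = 0}"
proof -
  interpret T: Vector_Spaces.linear scale scale T by fact
  interpret T': Vector_Spaces.linear scale scale T' by fact
  obtain B0 where B0: "B0 \<subseteq> range T" "independent B0" "range T \<subseteq> span B0" "card B0 = dim (range T)"
    by (rule basis_exists[of "range T"])
  obtain B where B: "B0 \<subseteq> B" "independent B" "UNIV \<subseteq> span B"
    using maximal_independent_subset_extend[OF subset_UNIV B0(2)] by metis
  define C where "C = B - B0"
  have finB: "finite B" using B(2) by (rule finiteI_independent)
  then have finC: "finite C" by (simp add: C_def)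
  have "card B = dim (UNIV :: 'b set)" using basis_card_eq_dim[OF subset_UNIV B(3,2)] .
  moreover have "card C = card B - card B0"
    unfolding C_def using B(1) finB by (intro card_Diff_subset) (auto dest: finite_subset)
  moreover have "dim (UNIV :: 'b set) = dim {x. T x = 0} + dim (range T)"
    using dim_image_add_dim_kernel[OF T subspace_UNIV] by simp
  ultimately have cardC: "card C = dim {x. T x = 0}" using B0(4) by simp
  define m where "m x = (\<Sum>c\<in>C. scale (basis_pairing x c) c)" for x
  have m: "Vector_Spaces.linear scale scale m"
    unfolding Defs.linear_iff[OF vector_space_axioms vector_space_axioms] m_def
    by (simp add: basis_pairing_linear scale_left_distrib sum.distrib scale_sum_right)
  have sub: "subspace {x. T' x = 0}"
    by (auto simp: subspace_def T'.add T'.scale T'.zero)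
  have "x = 0" if "T' x = 0" "m x = 0" for x
  proof -
    interpret \<phi>: Vector_Spaces.linear scale "(*)" "basis_pairing x" by (rule linear_basis_pairing)
    have "independent C" using B(2) by (rule independent_mono) (auto simp: C_def)
    then have "basis_pairing x c = 0" if "c \<in> C" for c
      using \<open>m x = 0\<close> independentD[of C C "basis_pairing x" c] that finC by (auto simp: m_def)
    moreover have "basis_pairing x b = 0" if b: "b \<in> B0" for b
    proof -
      obtain t where "b = T t" using B0(1) b by auto
      then show ?thesis using adj[of x t] \<open>T' x = 0\<close> by simp
    qed
    ultimately have "basis_pairing x b = 0" if "b \<in> B" for b using that by (auto simp: C_def)
    then have "basis_pairing x y = 0" for y
      using \<phi>.eq_0_on_span[of B y] B(3) by blast
    then show "x = 0" by (rule basis_pairing_nondegenerate)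
  qed
  then have "{x \<in> {x. T' x = 0}. m x = 0} \<subseteq> {0}" by auto
  then have "dim {x \<in> {x. T' x = 0}. m x = 0} = 0" by (simp only: dim_eq_0)
  moreover have "dim (m ` {x. T' x = 0}) \<le> card C"
  proof (rule dim_le_card[OF _ finC])
    have "m x \<in> span C" for x unfolding m_def by (intro span_sum span_scale) (rule span_base)
    then show "m ` {x. T' x = 0} \<subseteq> span C" by blast
  qed
  ultimately show ?thesis
    using dim_image_add_dim_kernel[OF m sub] cardC by linarith
qed

lemma dim_kernel_adjoint:
  assumes "Vector_Spaces.linear scale scale T" "Vector_Spaces.linear scale scale T'"
    and "\<And>x y. basis_pairing (T' x) y = basis_pairing x (T y)"
  shows "dim {x. T' x = 0} = dim {x. T x = 0}"
  using dim_kernel_adjoint_le[OF assms] dim_kernel_adjoint_le[OF assms(2,1)] assms(3)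
  by (metis basis_pairing_commute le_antisym)

end

section \<open>The polynomial action of an endomorphism\<close>

locale endomorphism =
  finite_dimensional_vector_space scale Basis + Vector_Spaces.linear scale scale U
  for scale :: "'f::field \<Rightarrow> 'v::ab_group_add \<Rightarrow> 'v" and Basis U
begin

abbreviation act :: "'f poly \<Rightarrow> 'v \<Rightarrow> 'v" where
  "act h \<equiv> poly_endo scale h U"

lemma act_eq_sum_le:
  assumes "Polynomial.degree h \<le> n"
  shows "act h x = (\<Sum>i\<le>n. scale (Polynomial.coeff h i) ((U ^^ i) x))"
  unfolding poly_endo_def
  by (rule sum.mono_neutral_left) (use assms in \<open>auto simp: coeff_eq_0\<close>)

lemma act_0 [simp]: "act 0 x = 0"
  by (simp add: poly_endo_def)

text \<open>Horner's rule, from which the laws of \<open>act\<close> follow by induction on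
  polynomials. The sum has to be padded with a zero coefficient, because \<open>pCons a h\<close>
  does not have degree one more than \<open>h\<close> when \<open>h = 0\<close>.\<close>

lemma act_pCons [simp]: "act (pCons a h) x = scale a x + U (act h x)"
proof -
  let ?n = "Polynomial.degree h"
  have "act (pCons a h) x = (\<Sum>i\<le>Suc ?n. scale (Polynomial.coeff (pCons a h) i) ((U ^^ i) x))"
    by (rule act_eq_sum_le) (rule degree_pCons_le)
  also have "\<dots> = scale a x + (\<Sum>i\<le>?n. scale (Polynomial.coeff h i) (U ((U ^^ i) x)))"
    by (subst sum.atMost_Suc_shift) simp
  also have "(\<Sum>i\<le>?n. scale (Polynomial.coeff h i) (U ((U ^^ i) x))) = U (act h x)"
    by (simp add: poly_endo_def sum scale)
  finally show ?thesis .
qed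

lemma act_1 [simp]: "act 1 x = x"
  by (simp add: one_pCons zero)

lemma act_add: "act (g + h) x = act g x + act h x"
proof (induction g arbitrary: h rule: pCons_induct)
  case (pCons a g)
  obtain b k where h: "h = pCons b k" by (cases h)
  have "act (pCons a g + h) x = (scale a x + scale b x) + (U (act g x) + U (act k x))"
    by (simp add: h pCons add scale_left_distrib)
  then show ?case by (simp only: h act_pCons ac_simps)
qed simp

lemma act_smult: "act (Polynomial.smult c h) x = scale c (act h x)"
  by (induction h rule: pCons_induct) (simp_all add: scale scale_right_distrib)

lemma act_uminus: "act (- h) x = - act h x"
  using act_smult[of "-1" h x] by simp

lemma act_diff: "act (g - h) x = act g x - act h x"
  using act_add[of g "- h" x] by (simp add: act_uminus)

lemma act_sum: "act (\<Sum>i\<in>I. h i) x = (\<Sum>i\<in>I. act (h i) x)"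
  by (induction I rule: infinite_finite_induct) (simp_all add: act_add)

lemma act_linear: "Vector_Spaces.linear scale scale (act h)"
proof (induction h rule: pCons_induct)
  case 0
  show ?case
    by (simp add: Defs.linear_iff[OF vector_space_axioms vector_space_axioms])
next
  case (pCons a h)
  then show ?case
    by (simp add: Defs.linear_iff[OF vector_space_axioms vector_space_axioms] add scale
        scale_right_distrib scale_left_commute algebra_simps)
qed

lemmas act_vec_0 [simp] = module_hom.zero[OF act_linear[folded module_hom_iff_linear]]
  and act_vec_add = module_hom.add[OF act_linear[folded module_hom_iff_linear]]
  and act_vec_diff = module_hom.diff[OF act_linear[folded module_hom_iff_linear]]
  and act_vec_scale = module_hom.scale[OF act_linear[folded module_hom_iff_linear]]
  and act_vec_sum = module_hom.sum[OF act_linear[folded module_hom_iff_linear]]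

lemma act_U: "act h (U x) = U (act h x)"
  by (induction h rule: pCons_induct) (simp_all add: zero add scale)

lemma act_mult: "act (g * h) x = act g (act h x)"
proof (induction g rule: pCons_induct)
  case (pCons a g)
  have "act (pCons a g * h) x = act (Polynomial.smult a h) x + act (pCons 0 (g * h)) x"
    by (simp add: act_add)
  then show ?case using pCons by (simp add: act_smult)
qed simp

lemma act_commute: "act g (act h x) = act h (act g x)"
  by (simp flip: act_mult add: mult.commute)

lemma act_power: "act (h ^ k) x = (act h ^^ k) x"
  by (induction k arbitrary: x) (simp_all add: act_mult)

lemma act_linear_factor: "act [:- l, 1:] x = U x - scale l x"
  by (simp add: zero)

lemma funpow_eq_act_power: "((\<lambda>y. U y - scale l y) ^^ k) x = act ([:- l, 1:] ^ k) x"
  by (simp add: act_power act_linear_factor[abs_def] del: act_pCons)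

lemma act_dvd_eq_0: "g dvd h \<Longrightarrow> act g x = 0 \<Longrightarrow> act h x = 0"
  by (metis act_mult act_vec_0 dvdE mult.commute)

definition ker_act :: "'f poly \<Rightarrow> 'v set" where
  "ker_act h = {x. act h x = 0}"

lemma mem_ker_act [simp]: "x \<in> ker_act h \<longleftrightarrow> act h x = 0"
  by (simp add: ker_act_def)

lemma subspace_ker_act: "subspace (ker_act h)"
  by (auto simp: subspace_def act_vec_add act_vec_scale)

lemma nk_eq: "nk scale U l k = dim (ker_act ([:- l, 1:] ^ k)) - dim (ker_act ([:- l, 1:] ^ (k - 1)))"
  by (simp add: nk_def funpow_eq_act_power ker_act_def)

lemma ker_act_mono: "g dvd h \<Longrightarrow> ker_act g \<subseteq> ker_act h"
  by (auto intro: act_dvd_eq_0)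

definition invariant :: "'v set \<Rightarrow> bool" where
  "invariant W \<longleftrightarrow> subspace W \<and> U ` W \<subseteq> W"

lemma invariant_act: "invariant W \<Longrightarrow> x \<in> W \<Longrightarrow> act h x \<in> W"
  by (induction h rule: pCons_induct)
    (auto simp: invariant_def subspace_0 subspace_add subspace_scale)

end

text \<open>A nonconstant polynomial has a root in the closure; by hypothesis this root comes from
  the base field, so a linear factor splits off there and the quotient inherits the
  hypothesis.\<close>

lemma poly_eq_prod_linear_factors:
  fixes h :: "'f::field poly"
  assumes "h \<noteq> 0" "\<And>z. poly (map_poly to_ac h) z = 0 \<Longrightarrow> z \<in> to_ac ` R"
  shows "\<exists>c as. h = Polynomial.smult c (\<Prod>a\<leftarrow>as. [:- a, 1:]) \<and> set as \<subseteq> R"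
  using assms
proof (induction "Polynomial.degree h" arbitrary: h)
  case 0
  then obtain c where "h = [:c:]" by (metis degree_eq_zeroE)
  then have "h = Polynomial.smult c (\<Prod>a\<leftarrow>[]. [:- a, 1:])" by simp
  then show ?case by (metis empty_subsetI list.set(1))
next
  case (Suc n)
  interpret to_ac: field_hom to_ac by unfold_locales auto
  interpret m: map_poly_inj_comm_ring_hom to_ac by unfold_locales
  have "Polynomial.degree (map_poly to_ac h) > 0" using Suc(2) by simp
  then obtain z where "poly (map_poly to_ac h) z = 0"
    using alg_closed_imp_poly_has_root by blast
  with Suc.prems obtain a where a: "a \<in> R" "z = to_ac a" by blast
  with \<open>poly (map_poly to_ac h) z = 0\<close> have "poly h a = 0" by simp
  then obtain g where g: "h = [:- a, 1:] * g" by (auto simp: poly_eq_0_iff_dvd elim: dvdE)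
  have "g \<noteq> 0" using g Suc.prems by auto
  have "n = Polynomial.degree g"
    using Suc(2) g \<open>g \<noteq> 0\<close> degree_mult_eq[of "[:- a, 1:]" g] by simp
  moreover have "z \<in> to_ac ` R" if "poly (map_poly to_ac g) z = 0" for z
    using that Suc.prems(2)[of z] unfolding g m.hom_mult by simp
  ultimately obtain c as where "g = Polynomial.smult c (\<Prod>a\<leftarrow>as. [:- a, 1:])" "set as \<subseteq> R"
    using Suc(1)[of g] \<open>g \<noteq> 0\<close> by blast
  then have "h = Polynomial.smult c (\<Prod>a\<leftarrow>a # as. [:- a, 1:])" "set (a # as) \<subseteq> R"
    using g a by simp_all
  then show ?case by blast
qed

section \<open>Cayley-Hamilton and an annihilating product of linear factors\<close>

context endomorphism
begin

lemma image_eq_sum_matrix_in_basis: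
  assumes "basis_list scale bs" "j < length bs"
  shows "U (bs ! j) = (\<Sum>i<length bs. scale (matrix_in_basis scale bs U $$ (i, j)) (bs ! i))"
proof -
  have bs: "distinct bs" "independent (set bs)" "span (set bs) = UNIV"
    using assms by (auto simp: basis_list_def)
  have "(\<Sum>i<length bs. scale (matrix_in_basis scale bs U $$ (i, j)) (bs ! i))
      = (\<Sum>i<length bs. scale (representation (set bs) (U (bs ! j)) (bs ! i)) (bs ! i))"
    using assms(2) by (auto simp: matrix_in_basis_def)
  also have "\<dots> = (\<Sum>b\<in>set bs. scale (representation (set bs) (U (bs ! j)) b) b)"
    by (rule sum.reindex_bij_betw[OF bij_betw_nth[OF bs(1)]]) auto
  also have "\<dots> = U (bs ! j)"
    by (rule sum_representation_eq) (use bs in auto)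
  finally show ?thesis ..
qed

text \<open>The vectors \<open>bs ! i\<close> satisfy the linear system over \<open>F[t]\<close> whose matrix is
  \<open>t I - M\<close>; multiplying by its adjugate shows that they are killed by its determinant.\<close>

lemma cayley_hamilton:
  assumes "basis_list scale bs"
  shows "act (char_poly (matrix_in_basis scale bs U)) x = 0"
proof -
  let ?n = "length bs"
  define M where "M = matrix_in_basis scale bs U"
  define K where "K = char_poly_matrix M"
  have M: "M \<in> carrier_mat ?n ?n" by (simp add: M_def matrix_in_basis_def)
  then have K: "K \<in> carrier_mat ?n ?n" by (simp add: K_def)
  note adj = adj_mat[OF K]
  have col: "(\<Sum>i<?n. act (K $$ (i, j)) (bs ! i)) = 0" if j: "j < ?n" for j
  proof -
    have "act (K $$ (i, j)) (bs ! i) = (if i = j then U (bs ! i) else 0) - scale (M $$ (i, j)) (bs ! i)"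
      if "i < ?n" for i
      using that j M by (simp add: K_def char_poly_matrix_def zero)
    then have "(\<Sum>i<?n. act (K $$ (i, j)) (bs ! i))
        = (\<Sum>i<?n. (if i = j then U (bs ! i) else 0)) - (\<Sum>i<?n. scale (M $$ (i, j)) (bs ! i))"
      by (simp add: sum_subtractf)
    then show ?thesis
      using j image_eq_sum_matrix_in_basis[OF assms j] by (simp add: M_def)
  qed
  have basis: "act (char_poly M) (bs ! k) = 0" if k: "k < ?n" for k
  proof -
    have entry: "(\<Sum>j<?n. K $$ (i, j) * adj_mat K $$ (j, k)) = (if i = k then char_poly M else 0)"
      if "i < ?n" for i
    proof -
      have "(K * adj_mat K) $$ (i, k) = (\<Sum>j<?n. K $$ (i, j) * adj_mat K $$ (j, k))"
        using that k K adj(1) by (simp add: scalar_prod_def lessThan_atLeast0)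
      then show ?thesis
        using that k adj(2) by (cases "i = k") (simp_all add: char_poly_def K_def)
    qed
    have "act (char_poly M) (bs ! k) = (\<Sum>i<?n. act (if i = k then char_poly M else 0) (bs ! i))"
      using k by (simp add: if_distrib[of "\<lambda>h. act h _"] cong: if_cong)
    also have "\<dots> = (\<Sum>i<?n. \<Sum>j<?n. act (adj_mat K $$ (j, k)) (act (K $$ (i, j)) (bs ! i)))"
      by (intro sum.cong refl)
        (simp add: act_sum mult.commute flip: entry act_mult)
    also have "\<dots> = (\<Sum>j<?n. act (adj_mat K $$ (j, k)) (\<Sum>i<?n. act (K $$ (i, j)) (bs ! i)))"
      by (subst sum.swap) (simp add: act_vec_sum)
    also have "\<dots> = 0" by (simp add: col)
    finally show ?thesis .
  qed
  have "x \<in> span (set bs)" using assms by (simp add: basis_list_def)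
  then have "x \<in> ker_act (char_poly M)"
    by (rule span_minimal[THEN subsetD, rotated -1])
      (auto simp: subspace_ker_act in_set_conv_nth basis)
  then show ?thesis by (simp add: M_def)
qed

text \<open>The roots of the characteristic polynomial in the closure are eigenvalues, hence
  differences of roots of split polynomials, hence elements of the base field. The characteristic
  polynomial therefore splits over that field, and Cayley-Hamilton applies to its
  factorization.\<close>

lemma exceptional_annihilated:
  assumes "pq_exceptional scale p q U" "splits p" "p \<noteq> 0" "splits q" "q \<noteq> 0"
  obtains as where "\<And>a. a \<in> set as \<Longrightarrow> to_ac a \<in> Root_diff p q"
    and "\<And>x. act (\<Prod>a\<leftarrow>as. [:- a, 1:]) x = 0"
proof -
  obtain bs where "set bs = Basis" "distinct bs"
    using finite_distinct_list[OF finite_Basis] by auto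
  then have bs: "basis_list scale bs"
    using independent_Basis span_Basis by (simp add: basis_list_def)
  define M where "M = matrix_in_basis scale bs U"
  have M: "M \<in> carrier_mat (length bs) (length bs)" by (simp add: M_def matrix_in_basis_def)
  interpret to_ac: field_hom to_ac by unfold_locales auto
  have cp: "char_poly (map_mat to_ac M) = map_poly to_ac (char_poly M)"
    by (rule to_ac.char_poly_hom[OF M])
  have nz: "char_poly M \<noteq> 0" using degree_monic_char_poly[OF M] by auto
  have "z \<in> to_ac ` {a. to_ac a \<in> Root_diff p q}"
    if "poly (map_poly to_ac (char_poly M)) z = 0" for z
  proof -
    have "eigenvalue (map_mat to_ac M) z"
      using that M by (subst eigenvalue_root_char_poly[of _ "length bs"]) (auto simp: cp)
    then have "z \<in> Root_diff p q"
      using assms(1) bs unfolding pq_exceptional_def ac_eigenvalue_def M_def by blast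
    then show ?thesis using Root_diff_subset_if_splits[OF assms(2-5)] by blast
  qed
  then obtain c as where as: "char_poly M = Polynomial.smult c (\<Prod>a\<leftarrow>as. [:- a, 1:])"
    "set as \<subseteq> {a. to_ac a \<in> Root_diff p q}"
    using poly_eq_prod_linear_factors[OF nz] by metis
  have "scale c (act (\<Prod>a\<leftarrow>as. [:- a, 1:]) x) = 0" for x
    using cayley_hamilton[OF bs, of x] by (simp add: act_smult flip: M_def as(1))
      (simp add: as(1) act_smult)
  then have "act (\<Prod>a\<leftarrow>as. [:- a, 1:]) x = 0" for x
    using nz as(1) by auto
  then show thesis using as(2) that by blast
qed

end

section \<open>Jordan decomposition\<close>

context endomorphism
begin

text \<open>\<open>W\<close> is the direct sum of the cyclic \<open>F[t]\<close>-modules generated by the \<open>z i\<close>, and the annihilator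
  of \<open>z i\<close> is generated by \<open>g i\<close>.\<close>

definition cyclic_decomposition ::
    "'v set \<Rightarrow> nat set \<Rightarrow> (nat \<Rightarrow> 'v) \<Rightarrow> (nat \<Rightarrow> 'f poly) \<Rightarrow> bool" where
  "cyclic_decomposition W I z g \<longleftrightarrow>
     finite I \<and> (\<forall>i\<in>I. act (g i) (z i) = 0) \<and>
     W = range (\<lambda>h. \<Sum>i\<in>I. act (h i) (z i)) \<and>
     (\<forall>h. (\<Sum>i\<in>I. act (h i) (z i)) = 0 \<longrightarrow> (\<forall>i\<in>I. g i dvd h i))"

text \<open>When the factors are applied to \<open>w\<close> one after the other, the last nonzero
  vector obtained is an eigenvector.\<close>

lemma invariant_eigenvector:
  assumes "invariant W" "w \<in> W" "w \<noteq> 0" "act (\<Prod>a\<leftarrow>as. [:- a, 1:]) w = 0"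
  shows "\<exists>a\<in>set as. \<exists>x\<in>W. x \<noteq> 0 \<and> act [:- a, 1:] x = 0"
  using assms(2-4)
proof (induction as arbitrary: w)
  case (Cons a as)
  show ?case
  proof (cases "act [:- a, 1:] w = 0")
    case False
    have "act (\<Prod>a\<leftarrow>as. [:- a, 1:]) (act [:- a, 1:] w) = 0"
      using Cons.prems(3) by (simp only: list.map prod_list.Cons act_mult act_commute)
    then show ?thesis
      using Cons.IH[OF invariant_act[OF assms(1) Cons.prems(1)] False] by auto
  qed (use Cons.prems in auto)
qed simp

lemma act_eigenvector:
  assumes "act [:- a, 1:] x = 0"
  shows "act h x = scale (poly h a) x"
  using assms by (induction h rule: pCons_induct) (simp_all add: zero scale scale_left_distrib mult.commute)

text \<open>The kernels of the powers of \<open>g\<close> on \<open>W\<close> form an ascending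
  chain, which stops for reasons of dimension. Taking the least index at which it stops provides,
  unless that index is 0, a vector killed by the power \<open>n\<close> but not by
  \<open>n - 1\<close>.\<close>

lemma kernel_stabilizes:
  assumes "invariant W"
  obtains n where "\<And>x k. x \<in> W \<Longrightarrow> act (g ^ k) x = 0 \<Longrightarrow> act (g ^ n) x = 0"
    and "n = 0 \<or> (\<exists>x\<in>W. act (g ^ n) x = 0 \<and> act (g ^ (n - 1)) x \<noteq> 0)"
proof -
  define K where "K k = W \<inter> ker_act (g ^ k)" for k
  have sub: "subspace (K k)" for k
    using assms unfolding K_def invariant_def by (intro subspace_inter subspace_ker_act) auto
  have mono: "K k \<subseteq> K (Suc k)" for k
    unfolding K_def using ker_act_mono[of "g ^ k" "g ^ Suc k"] by auto
  have ex: "\<exists>k. K k = K (Suc k)"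
  proof (rule ccontr)
    assume "\<nexists>k. K k = K (Suc k)"
    then have "K k \<subset> K (Suc k)" for k using mono by blast
    then have "dim (K k) < dim (K (Suc k))" for k
      by (intro dim_psubset) (simp add: span_eq_iff[THEN iffD2] sub)
    then have "k \<le> dim (K k)" for k
      by (induction k) (auto simp: Suc_le_eq intro: le_less_trans)
    from this[of "Suc dimension"] show False
      using dim_subset_UNIV[of "K (Suc dimension)"] by simp
  qed
  define n where "n = (LEAST k. K k = K (Suc k))"
  have n: "K n = K (Suc n)" unfolding n_def using ex by (rule LeastI_ex)
  have stab: "act (g ^ n) x = 0" if "x \<in> W" "act (g ^ (n + j)) x = 0" for x j
    using that(2)
  proof (induction j)
    case (Suc j)
    have "act (g ^ Suc n) (act (g ^ j) x) = 0"
      using Suc.prems by (simp only: act_mult[symmetric] power_add[symmetric]) simp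
    then have "act (g ^ j) x \<in> K (Suc n)"
      using invariant_act[OF assms \<open>x \<in> W\<close>] by (simp add: K_def)
    then have "act (g ^ n) (act (g ^ j) x) = 0" unfolding n[symmetric] by (simp add: K_def)
    then show ?case by (intro Suc.IH) (simp only: power_add act_mult)
  qed simp
  show thesis
  proof
    show "act (g ^ n) x = 0" if "x \<in> W" "act (g ^ k) x = 0" for x k
      using stab[of x k] that act_dvd_eq_0[of "g ^ k" "g ^ (n + k)" x] by (simp add: power_add)
    show "n = 0 \<or> (\<exists>x\<in>W. act (g ^ n) x = 0 \<and> act (g ^ (n - 1)) x \<noteq> 0)"
    proof (cases n)
      case (Suc m)
      then have "K m \<noteq> K (Suc m)" using not_less_Least[of m "\<lambda>k. K k = K (Suc k)"] by (auto simp: n_def)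
      then show ?thesis using mono[of m] Suc by (auto simp: K_def)
    qed simp
  qed
qed

lemma functional_separating:
  assumes "subspace S" "y \<notin> S"
  obtains \<phi> where "Vector_Spaces.linear scale (*) \<phi>" "\<phi> y = 1" "\<And>x. x \<in> S \<Longrightarrow> \<phi> x = 0"
proof -
  interpret pair: vector_space_pair scale "(*) :: 'f \<Rightarrow> 'f \<Rightarrow> 'f"
    using vector_space_axioms vector_space_field by (rule vector_space_pair.intro)
  obtain B where B: "B \<subseteq> S" "independent B" "S \<subseteq> span B"
    by (rule basis_exists[of S])
  have "span B = S" using B assms(1) by (metis span_minimal subset_antisym)
  then have "independent (insert y B)" using B assms(2) by (simp add: independent_insert)
  then obtain \<phi> where \<phi>: "Vector_Spaces.linear scale (*) \<phi>"
    "\<forall>x\<in>insert y B. \<phi> x = (if x = y then 1 else 0)"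
    using pair.linear_independent_extend[of "insert y B" "\<lambda>x. if x = y then 1 else 0"] by blast
  interpret \<phi>: Vector_Spaces.linear scale "(*)" \<phi> by fact
  have "y \<notin> B" using B(1) assms(2) by auto
  then have "\<phi> b = 0" if "b \<in> B" for b using \<phi>(2) that by auto
  then have "\<phi> x = 0" if "x \<in> S" for x
    using \<phi>.eq_0_on_span[of B x] that B(3) by blast
  then show thesis using \<phi> that by auto
qed

text \<open>\<open>x\<close> is a vector of maximal height \<open>n\<close> for \<open>N = U - a\<close>, and the complement of the module it generates
  consists of the \<open>w\<close> with \<open>\<phi> (N\<^sup>k w) = 0\<close> for all \<open>k\<close>, where the functional \<open>\<phi>\<close> does not
  vanish at \<open>N\<^sup>n\<^sup>-\<^sup>1 x\<close> but kills \<open>N\<^sup>n W\<close>.\<close>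

lemma invariant_complement:
  assumes W: "invariant W" and eig: "x1 \<in> W" "x1 \<noteq> 0" "act [:- a, 1:] x1 = 0"
  obtains x n C where "x \<in> W" "act ([:- a, 1:] ^ n) x = 0"
    "invariant C" "C \<subset> W" "\<And>h. act h x \<in> C \<Longrightarrow> [:- a, 1:] ^ n dvd h"
    "\<And>w. w \<in> W \<Longrightarrow> \<exists>h. w - act h x \<in> C"
proof -
  let ?L = "[:- a, 1:]"
  have subW: "subspace W" using W by (simp add: invariant_def)
  obtain n where n: "\<And>x k. x \<in> W \<Longrightarrow> act (?L ^ k) x = 0 \<Longrightarrow> act (?L ^ n) x = 0"
    "n = 0 \<or> (\<exists>x\<in>W. act (?L ^ n) x = 0 \<and> act (?L ^ (n - 1)) x \<noteq> 0)"
    using kernel_stabilizes[OF W, of ?L] by metis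
  have "n \<noteq> 0" using n(1)[of x1 1] eig by (cases n) (auto simp del: act_pCons)
  then have "n \<ge> 1" by simp
  obtain x where x: "x \<in> W" "act (?L ^ n) x = 0" "act (?L ^ (n - 1)) x \<noteq> 0"
    using n(2) \<open>n \<noteq> 0\<close> by auto
  have x_ge: "act (?L ^ k) x = 0" if "k \<ge> n" for k
    using act_dvd_eq_0[OF le_imp_power_dvd[OF that] x(2)] .
  define y where "y = act (?L ^ (n - 1)) x"
  define S where "S = act (?L ^ n) ` W"
  interpret L: Vector_Spaces.linear scale scale "act (?L ^ n)" by (rule act_linear)
  have "subspace S" unfolding S_def by (rule L.subspace_image[OF subW])
  have Ly: "act ?L y = 0"
    using x(2) \<open>n \<ge> 1\<close> unfolding y_def
    by (simp only: act_mult[symmetric] power_Suc[symmetric]) simp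
  \<comment> \<open>Here the maximality of the height \<open>n\<close> is used: if
    \<open>y = N^n w\<close> with \<open>N = U - a\<close>, then \<open>N^(n+1) w = 0\<close>, so
    already \<open>N^n w = 0\<close>.\<close>
  have "y \<notin> S"
  proof
    assume "y \<in> S"
    then obtain w where w: "w \<in> W" "y = act (?L ^ n) w" by (auto simp: S_def)
    then have "act (?L ^ Suc n) w = 0" using Ly by (simp only: power_Suc act_mult)
    then have "y = 0" using n(1)[of w] w by blast
    then show False using x(3) by (simp add: y_def)
  qed
  obtain \<phi> where \<phi>: "Vector_Spaces.linear scale (*) \<phi>" "\<phi> y = 1" "\<And>x. x \<in> S \<Longrightarrow> \<phi> x = 0"
    using functional_separating[OF \<open>subspace S\<close> \<open>y \<notin> S\<close>] by blast
  interpret \<phi>: Vector_Spaces.linear scale "(*)" \<phi> by fact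
  have \<phi>_ge: "\<phi> (act (?L ^ k) w) = 0" if "k \<ge> n" "w \<in> W" for k w
  proof -
    have "act (?L ^ k) w = act (?L ^ n) (act (?L ^ (k - n)) w)"
      using that(1) by (simp only: act_mult[symmetric] power_add[symmetric]) simp
    then show ?thesis
      using \<phi>(3) invariant_act[OF W that(2)] by (auto simp: S_def)
  qed
  define C where "C = {w \<in> W. \<forall>k. \<phi> (act (?L ^ k) w) = 0}"
  have U_eq: "U w = act ?L w + scale a w" for w by (simp add: act_linear_factor del: act_pCons)
  have "\<phi> (act (?L ^ k) (U w)) = \<phi> (act (?L ^ Suc k) w) + a * \<phi> (act (?L ^ k) w)" for k w
    by (subst U_eq) (simp only: act_vec_add act_vec_scale \<phi>.add \<phi>.scale power_Suc2 act_mult)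
  then have "invariant C"
    using W by (auto simp: invariant_def C_def subspace_def act_vec_add act_vec_scale \<phi>.add \<phi>.scale
        \<phi>.zero simp del: power_Suc)
  have "x \<notin> C"
    using \<phi>(2) by (auto simp: C_def y_def simp del: act_pCons intro!: exI[of _ "n - 1"])
  \<comment> \<open>If \<open>h\<close> had order \<open>j < n\<close> at \<open>a\<close>, applying
    \<open>(U - a)^(n-1-j)\<close> to \<open>act h x\<close> would leave just a nonzero multiple of
    the eigenvector \<open>y\<close>, on which \<phi> does not vanish.\<close>
  have indep: "?L ^ n dvd h" if "act h x \<in> C" for h
  proof (rule ccontr)
    assume ndvd: "\<not> ?L ^ n dvd h"
    then have "h \<noteq> 0" by auto
    then obtain r where r: "h = ?L ^ Polynomial.order a h * r" "\<not> ?L dvd r"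
      using order_decomp by blast
    let ?j = "Polynomial.order a h"
    have "?j < n" using ndvd r(1) by (metis dvd_triv_left le_imp_power_dvd dvd_trans not_le)
    then have "act (?L ^ (n - 1 - ?j)) (act h x) = act (?L ^ (n - 1 - ?j) * (?L ^ ?j * r)) x"
      by (subst r(1)) (simp only: act_mult)
    also have "?L ^ (n - 1 - ?j) * (?L ^ ?j * r) = r * ?L ^ (n - 1)"
      using \<open>?j < n\<close> by (simp only: mult.assoc[symmetric] power_add[symmetric] mult.commute[of r]) simp
    also have "act (r * ?L ^ (n - 1)) x = scale (poly r a) y"
      unfolding y_def[symmetric] act_mult by (rule act_eigenvector[OF Ly])
    finally have "poly r a = 0"
      using that \<phi>(2) by (auto simp: C_def \<phi>.scale simp del: act_pCons dest: spec[of _ "n - 1 - ?j"])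
    then show False using r(2) by (simp add: poly_eq_0_iff_dvd)
  qed
  have gen: "\<exists>h. w - act h x \<in> C" if w: "w \<in> W" for w
  proof -
    \<comment> \<open>Descending elimination. The correction \<open>c * (t - a)^m\<close> cancels
      the value at \<open>k = n - Suc m\<close>, because \<phi> takes the value 1 at
      \<open>y\<close>; it leaves the values at larger \<open>k\<close> alone, because
      \<open>x\<close> is killed by \<open>(U - a)^n\<close>.\<close>
    have "\<exists>h. \<forall>k\<ge>n - m. \<phi> (act (?L ^ k) (w - act h x)) = 0" if "m \<le> n" for m
      using that
    proof (induction m)
      case 0
      show ?case using \<phi>_ge w by (intro exI[of _ 0]) auto
    next
      case (Suc m)
      then obtain h where h: "\<And>k. k \<ge> n - m \<Longrightarrow> \<phi> (act (?L ^ k) (w - act h x)) = 0" by auto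
      define c where "c = \<phi> (act (?L ^ (n - Suc m)) (w - act h x))"
      define h' where "h' = h + Polynomial.smult c (?L ^ m)"
      have eq: "\<phi> (act (?L ^ k) (w - act h' x))
          = \<phi> (act (?L ^ k) (w - act h x)) - c * \<phi> (act (?L ^ (k + m)) x)" for k
        by (simp only: h'_def act_add act_smult power_add act_mult diff_diff_eq[symmetric]
            act_vec_diff act_vec_scale \<phi>.diff \<phi>.scale)
      have "\<phi> (act (?L ^ k) (w - act h' x)) = 0" if "k \<ge> n - Suc m" for k
      proof (cases "k = n - Suc m")
        case True
        then have "k + m = n - 1" using Suc.prems by simp
        then show ?thesis using \<phi>(2) by (simp only: eq) (simp add: True c_def y_def del: act_pCons)
      next
        case False
        then have "k \<ge> n - m" "k + m \<ge> n" using that Suc.prems by simp_all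
        then show ?thesis by (simp only: eq h x_ge \<phi>.zero mult_zero_right diff_zero)
      qed
      then show ?case by blast
    qed
    from this[of n] obtain h where "\<And>k. \<phi> (act (?L ^ k) (w - act h x)) = 0" by auto
    moreover have "w - act h x \<in> W"
      by (intro subspace_diff subW w invariant_act[OF W x(1)])
    ultimately show ?thesis unfolding C_def by blast
  qed
  have "C \<subset> W" using \<open>x \<notin> C\<close> x(1) by (auto simp: C_def)
  show thesis by (rule that[OF x(1) x(2) \<open>invariant C\<close> \<open>C \<subset> W\<close> indep gen])
qed

lemma sum_act_insert:
  assumes "i0 \<notin> I" "finite I"
  shows "(\<Sum>i\<in>insert i0 I. act (h i) ((z(i0 := x)) i)) = act (h i0) x + (\<Sum>i\<in>I. act (h i) (z i))"
  using assms by (auto intro!: sum.cong)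

text \<open>Induction on the dimension, splitting off one cyclic summand generated by a vector of
  maximal height. The indices are natural numbers, so that a fresh one is always available.\<close>

theorem jordan_decomposition:
  assumes "invariant W" "\<And>x. x \<in> W \<Longrightarrow> act (\<Prod>a\<leftarrow>as. [:- a, 1:]) x = 0"
  shows "\<exists>I z l m. cyclic_decomposition W I z (\<lambda>i. [:- l i, 1:] ^ m i) \<and>
           (\<forall>i\<in>I. l i \<in> set as)"
  using assms
proof (induction "dim W" arbitrary: W rule: less_induct)
  case less
  show ?case
  proof (cases "W = {0}")
    case True
    then have "cyclic_decomposition W {} z g" for z g
      by (auto simp: cyclic_decomposition_def)
    then show ?thesis by blast
  next
    case False
    moreover have "0 \<in> W" using less.prems by (simp add: invariant_def subspace_0)
    ultimately obtain w where "w \<in> W" "w \<noteq> 0" by blast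
    then obtain a x1 where a: "a \<in> set as" "x1 \<in> W" "x1 \<noteq> 0" "act [:- a, 1:] x1 = 0"
      using invariant_eigenvector[OF less.prems(1)] less.prems(2) by metis
    obtain x n C where C: "x \<in> W" "act ([:- a, 1:] ^ n) x = 0"
      "invariant C" "C \<subset> W" "\<And>h. act h x \<in> C \<Longrightarrow> [:- a, 1:] ^ n dvd h"
      "\<And>w. w \<in> W \<Longrightarrow> \<exists>h. w - act h x \<in> C"
      by (rule invariant_complement[OF less.prems(1) a(2-4)]) (rule that)
    have sub: "subspace C" "subspace W" using C(3) less.prems(1) by (auto simp: invariant_def)
    then have "dim C < dim W"
      using C(4) by (intro dim_psubset) (simp add: span_eq_iff[THEN iffD2])
    then obtain I z l m where I: "cyclic_decomposition C I z (\<lambda>i. [:- l i, 1:] ^ m i)"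
      "\<forall>i\<in>I. l i \<in> set as"
      using less.hyps[of C] C(3,4) less.prems(2) by blast
    then have I': "finite I" "\<And>i. i \<in> I \<Longrightarrow> act ([:- l i, 1:] ^ m i) (z i) = 0"
      "C = range (\<lambda>h. \<Sum>i\<in>I. act (h i) (z i))"
      "\<And>h i. (\<Sum>i\<in>I. act (h i) (z i)) = 0 \<Longrightarrow> i \<in> I \<Longrightarrow> [:- l i, 1:] ^ m i dvd h i"
      by (auto simp: cyclic_decomposition_def simp del: act_pCons)
    obtain i0 where i0: "i0 \<notin> I" using ex_new_if_finite[OF infinite_UNIV_nat I'(1)] by auto
    note sum_eq = sum_act_insert[OF i0 I'(1), of _ z x]
    have "cyclic_decomposition W (insert i0 I) (z(i0 := x))
        (\<lambda>i. [:- (l(i0 := a)) i, 1:] ^ (m(i0 := n)) i)"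
      unfolding cyclic_decomposition_def sum_eq
    proof (intro conjI allI impI ballI)
      show "finite (insert i0 I)" using I' by simp
      show "act ([:- (l(i0 := a)) i, 1:] ^ (m(i0 := n)) i) ((z(i0 := x)) i) = 0"
        if "i \<in> insert i0 I" for i
        using that C(2) I'(2) by (auto simp del: act_pCons)
      show "W = range (\<lambda>h. act (h i0) x + (\<Sum>i\<in>I. act (h i) (z i)))"
      proof (intro equalityI subsetI)
        fix w assume "w \<in> W"
        then obtain h where "w - act h x \<in> C" using C(6) by blast
        then obtain k where "w - act h x = (\<Sum>i\<in>I. act (k i) (z i))" using I'(3) by auto
        moreover have "(\<Sum>i\<in>I. act ((k(i0 := h)) i) (z i)) = (\<Sum>i\<in>I. act (k i) (z i))"
          using i0 by (auto intro!: sum.cong)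
        ultimately have "w = act ((k(i0 := h)) i0) x + (\<Sum>i\<in>I. act ((k(i0 := h)) i) (z i))"
          by (simp add: algebra_simps)
        then show "w \<in> range (\<lambda>h. act (h i0) x + (\<Sum>i\<in>I. act (h i) (z i)))" by blast
      next
        fix w assume "w \<in> range (\<lambda>h. act (h i0) x + (\<Sum>i\<in>I. act (h i) (z i)))"
        then obtain h where h: "w = act (h i0) x + (\<Sum>i\<in>I. act (h i) (z i))" by blast
        have "(\<Sum>i\<in>I. act (h i) (z i)) \<in> W" using I'(3) C(4) by blast
        then show "w \<in> W"
          unfolding h by (intro subspace_add sub invariant_act[OF less.prems(1)] C(1))
      qed
      fix h i
      assume eq: "act (h i0) x + (\<Sum>i\<in>I. act (h i) (z i)) = 0" and i: "i \<in> insert i0 I"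
      have "(\<Sum>i\<in>I. act (h i) (z i)) \<in> C" using I'(3) by blast
      then have "- (\<Sum>i\<in>I. act (h i) (z i)) \<in> C" using sub subspace_neg by blast
      then have "act (h i0) x \<in> C" using eq by (simp add: eq_neg_iff_add_eq_0[symmetric])
      then have dvd: "[:- a, 1:] ^ n dvd h i0" by (rule C(5))
      then have "act (h i0) x = 0" using C(2) act_dvd_eq_0 by blast
      with eq have "(\<Sum>i\<in>I. act (h i) (z i)) = 0" by simp
      then show "[:- (l(i0 := a)) i, 1:] ^ (m(i0 := n)) i dvd h i"
        using I'(4) i dvd i0 by auto
    qed
    moreover have "\<forall>i\<in>insert i0 I. (l(i0 := a)) i \<in> set as"
      using I(2) a(1) by auto
    ultimately show ?thesis by blast
  qed
qed


section \<open>Reading the numbers \<open>nk\<close> off a Jordan decomposition\<close>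

lemma linear_power_dvd_cancel:
  "[:- (a :: 'f), 1:] ^ (i + j) dvd [:- a, 1:] ^ i * h \<longleftrightarrow> [:- a, 1:] ^ j dvd h"
  by (simp add: power_add)

text \<open>Each block for \<open>a\<close> of size at least \<open>k\<close> contributes exactly
  one dimension to the kernel of \<open>(U - a)^k\<close> modulo that of
  \<open>(U - a)^(k-1)\<close>, represented by \<open>(U - a)^(m i - k)\<close> applied to its
  generator.\<close>

theorem nk_eq_card_blocks:
  assumes dec: "cyclic_decomposition UNIV I z (\<lambda>i. [:- l i, 1:] ^ m i)" and "k \<ge> 1"
  shows "nk scale U a k = card {i \<in> I. l i = a \<and> m i \<ge> k}"
proof -
  let ?L = "[:- a, 1:]"
  define J where "J = {i \<in> I. l i = a \<and> m i \<ge> k}"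
  define e where "e i = act (?L ^ (m i - k)) (z i)" for i
  have I: "finite I" "\<And>i. i \<in> I \<Longrightarrow> act ([:- l i, 1:] ^ m i) (z i) = 0"
    "\<And>x. \<exists>h. x = (\<Sum>i\<in>I. act (h i) (z i))"
    "\<And>h i. (\<Sum>i\<in>I. act (h i) (z i)) = 0 \<Longrightarrow> i \<in> I \<Longrightarrow> [:- l i, 1:] ^ m i dvd h i"
    using dec by (auto simp: cyclic_decomposition_def set_eq_iff image_iff simp del: act_pCons)
  have J: "finite J" "J \<subseteq> I" using I(1) by (auto simp: J_def)
  have sum_J: "(\<Sum>i\<in>J. act (h i) (z i)) = (\<Sum>i\<in>I. act (if i \<in> J then h i else 0) (z i))" for h
    using J by (simp add: if_distrib[of "\<lambda>h. act h _"] sum.If_cases I(1) Int_absorb1 cong: if_cong)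
  have sum_e: "(\<Sum>i\<in>J. scale (c i) (e i)) = (\<Sum>i\<in>J. act (Polynomial.smult (c i) (?L ^ (m i - k))) (z i))" for c
    by (simp add: e_def act_smult)
  have "dim (ker_act (?L ^ k)) = dim (ker_act (?L ^ (k - 1))) + card J"
  proof (rule dim_eq_add_card[where e = e])
    show "ker_act (?L ^ (k - 1)) \<subseteq> ker_act (?L ^ k)"
      by (rule ker_act_mono) (simp add: le_imp_power_dvd)
    show "e ` J \<subseteq> ker_act (?L ^ k)"
    proof clarsimp
      fix i assume "i \<in> J"
      then have "?L ^ k * ?L ^ (m i - k) = [:- l i, 1:] ^ m i"
        by (simp add: J_def flip: power_add)
      then show "act (?L ^ k) (e i) = 0"
        using I(2) \<open>i \<in> J\<close> J by (auto simp: e_def simp flip: act_mult)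
    qed
    show "c i = 0" if S: "(\<Sum>i\<in>J. scale (c i) (e i)) \<in> ker_act (?L ^ (k - 1))" and i: "i \<in> J" for c i
    proof -
      have "(\<Sum>i\<in>J. act (?L ^ (k - 1) * Polynomial.smult (c i) (?L ^ (m i - k))) (z i)) = 0"
        using S unfolding sum_e by (simp only: mem_ker_act act_vec_sum act_mult)
      then have "?L ^ m i dvd ?L ^ (k - 1) * Polynomial.smult (c i) (?L ^ (m i - k))"
        using I(4)[OF _ subsetD[OF J(2) i]] i unfolding sum_J by (fastforce simp: J_def)
      also have "?L ^ (k - 1) * Polynomial.smult (c i) (?L ^ (m i - k)) = ?L ^ (m i - 1) * [:c i:]"
        using i \<open>k \<ge> 1\<close> by (simp add: J_def flip: power_add)
      also have "?L ^ m i = ?L ^ (m i - 1 + 1)" using i \<open>k \<ge> 1\<close> by (simp add: J_def)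
      finally have "?L ^ 1 dvd [:c i:]" by (simp only: linear_power_dvd_cancel)
      then have "?L dvd [:c i:]" by simp
      then show "c i = 0" by (simp flip: poly_eq_0_iff_dvd)
    qed
    show "\<exists>c. x - (\<Sum>i\<in>J. scale (c i) (e i)) \<in> ker_act (?L ^ (k - 1))" if "x \<in> ker_act (?L ^ k)" for x
    proof -
      obtain h where h: "x = (\<Sum>i\<in>I. act (h i) (z i))" using I(3) by blast
      have "(\<Sum>i\<in>I. act ((\<lambda>i. ?L ^ k * h i) i) (z i)) = 0"
        using that by (simp add: h act_vec_sum act_mult)
      then have dvd: "[:- l i, 1:] ^ m i dvd ?L ^ k * h i" if "i \<in> I" for i
        using I(4)[OF \<open>(\<Sum>i\<in>I. act ((\<lambda>i. ?L ^ k * h i) i) (z i)) = 0\<close> that] by simp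
      have "\<exists>r. h i = ?L ^ (m i - k) * r" if "i \<in> J" for i
      proof -
        have "?L ^ (k + (m i - k)) dvd ?L ^ k * h i" using dvd[of i] that by (simp add: J_def)
        then have "?L ^ (m i - k) dvd h i" by (simp only: linear_power_dvd_cancel)
        then show ?thesis by (auto elim: dvdE)
      qed
      then obtain r where r: "\<And>i. i \<in> J \<Longrightarrow> h i = ?L ^ (m i - k) * r i" by metis
      \<comment> \<open>Only the residue of \<open>r i\<close> modulo \<open>t - a\<close> matters:
        a further factor \<open>t - a\<close> lands in the kernel of the power
        \<open>k - 1\<close>.\<close>
      define c where "c i = poly (r i) a" for i
      have zero: "act (?L ^ (k - 1)) (act (h i - (if i \<in> J then Polynomial.smult (c i) (?L ^ (m i - k)) else 0)) (z i)) = 0"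
        if "i \<in> I" for i
      proof -
        let ?h = "h i - (if i \<in> J then Polynomial.smult (c i) (?L ^ (m i - k)) else 0)"
        have "[:- l i, 1:] ^ m i dvd ?L ^ (k - 1) * ?h"
        proof (cases "i \<in> J")
          case True
          have "?L dvd r i - [:c i:]" by (simp add: c_def flip: poly_eq_0_iff_dvd)
          then have "?L ^ (m i - 1 + 1) dvd ?L ^ (m i - 1) * (r i - [:c i:])"
            using linear_power_dvd_cancel[of a "m i - 1" 1] by simp
          also have "?L ^ (m i - 1) * (r i - [:c i:]) = ?L ^ (k - 1) * (?L ^ (m i - k) * (r i - [:c i:]))"
            using True \<open>k \<ge> 1\<close> by (simp add: J_def flip: power_add mult.assoc)
          also have "?L ^ (m i - k) * (r i - [:c i:]) = ?h"
            using r[OF True] True by (simp add: algebra_simps)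
          finally have "?L ^ (m i - 1 + 1) dvd ?L ^ (k - 1) * ?h" .
          moreover have "m i - 1 + 1 = m i" "l i = a" using True \<open>k \<ge> 1\<close> by (simp_all add: J_def)
          ultimately show ?thesis by (simp only:)
        next
          \<comment> \<open>Outside \<open>J\<close> nothing is subtracted. A block for
            \<open>a\<close> of size less than \<open>k\<close> is killed by
            \<open>?L ^ (k - 1)\<close>; for another eigenvalue \<open>?L ^ k\<close> is coprime to
            the annihilator, which must therefore divide \<open>h i\<close> itself.\<close>
          case False
          show ?thesis
          proof (cases "l i = a")
            case True
            then have "m i \<le> k - 1" using False that by (auto simp: J_def)
            then show ?thesis using True by (simp add: le_imp_power_dvd dvd_mult2)
          next
            case ne: False
            have "[:- l i, 1:] ^ m i dvd h i"
              using dvd[OF that] comaximal_dvd_mult[OF comaximal_powers[OF comaximal_linear[OF ne]]]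
              by blast
            then show ?thesis using False by simp
          qed
        qed
        then have "act (?L ^ (k - 1) * ?h) (z i) = 0" using I(2)[OF that] act_dvd_eq_0 by blast
        then show ?thesis by (simp only: act_mult)
      qed
      have "x - (\<Sum>i\<in>J. scale (c i) (e i)) =
          (\<Sum>i\<in>I. act (h i - (if i \<in> J then Polynomial.smult (c i) (?L ^ (m i - k)) else 0)) (z i))"
        unfolding sum_e sum_J h by (simp only: sum_subtractf act_diff)
      then have "act (?L ^ (k - 1)) (x - (\<Sum>i\<in>J. scale (c i) (e i))) = 0"
        using zero by (simp only: act_vec_sum) simp
      then show ?thesis by auto
    qed
  qed (simp_all add: subspace_ker_act J)
  then show ?thesis by (simp add: nk_eq J_def)
qed

end

section \<open>Sufficiency: pairing Jordan blocks\<close>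

lemma finite_max_nat:
  fixes m :: "'a \<Rightarrow> nat"
  assumes "finite S" "S \<noteq> {}"
  obtains i where "i \<in> S" "\<And>k. k \<in> S \<Longrightarrow> m k \<le> m i"
proof -
  have "Max (m ` S) \<in> m ` S" using assms by (intro Max_in) auto
  then obtain i where "i \<in> S" "Max (m ` S) = m i" by auto
  then show thesis using assms(1) that Max_ge[of "m ` S"] by (metis finite_imageI imageI)
qed

context endomorphism
begin

text \<open>The sum of the two generators is stored at \<open>i\<close>, and \<open>j\<close> is
  deleted. A combination of the new family is a combination of the old one whose coefficients at
  \<open>i\<close> and \<open>j\<close> coincide, so \<open>sum_eq\<close> reduces every claim to
  the old decomposition.\<close>

lemma merge_cyclic_summands:
  assumes dec: "cyclic_decomposition W I z g" and ij: "i \<in> I" "j \<in> I" "i \<noteq> j"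
    and "comaximal (g i) (g j)"
  shows "cyclic_decomposition W (I - {j}) (z(i := z i + z j)) (g(i := g i * g j))"
proof -
  have I: "finite I" "\<And>k. k \<in> I \<Longrightarrow> act (g k) (z k) = 0"
    "W = range (\<lambda>h. \<Sum>k\<in>I. act (h k) (z k))"
    "\<And>h k. (\<Sum>k\<in>I. act (h k) (z k)) = 0 \<Longrightarrow> k \<in> I \<Longrightarrow> g k dvd h k"
    using dec by (auto simp: cyclic_decomposition_def)
  have split: "(\<Sum>k\<in>I. f k) = f i + (f j + (\<Sum>k\<in>I - {i, j}. f k))" for f :: "nat \<Rightarrow> 'v"
  proof -
    have "I = insert i (insert j (I - {i, j}))" using ij by auto
    then have "(\<Sum>k\<in>I. f k) = (\<Sum>k\<in>insert i (insert j (I - {i, j})). f k)" by simp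
    then show ?thesis using I(1) ij by simp
  qed
  have sum_eq: "(\<Sum>k\<in>I - {j}. act (h k) ((z(i := z i + z j)) k)) = (\<Sum>k\<in>I. act ((h(j := h i)) k) (z k))"
    for h
  proof -
    have "(\<Sum>k\<in>I - {j}. act (h k) ((z(i := z i + z j)) k))
        = act (h i) (z i + z j) + (\<Sum>k\<in>I - {j} - {i}. act (h k) ((z(i := z i + z j)) k))"
      using I(1) ij by (subst sum.remove[of _ i]) auto
    also have "(\<Sum>k\<in>I - {j} - {i}. act (h k) ((z(i := z i + z j)) k)) = (\<Sum>k\<in>I - {i, j}. act (h k) (z k))"
      by (rule sum.cong) auto
    also have "\<dots> = (\<Sum>k\<in>I - {i, j}. act ((h(j := h i)) k) (z k))"
      by (rule sum.cong) auto
    finally show ?thesis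
      unfolding split[of "\<lambda>k. act ((h(j := h i)) k) (z k)"] using ij
      by (simp add: act_vec_add add.assoc)
  qed
  obtain s t where st: "s * g i + t * g j = 1" using assms(5) by (auto simp: comaximal_def)
  show ?thesis
    unfolding cyclic_decomposition_def sum_eq
  proof (intro conjI ballI allI impI)
    show "act ((g(i := g i * g j)) k) ((z(i := z i + z j)) k) = 0" if "k \<in> I - {j}" for k
    proof (cases "k = i")
      case True
      have "act (g i * g j) (z i) = 0" "act (g i * g j) (z j) = 0"
        using I(2) ij by (auto intro: act_dvd_eq_0[of "g i"] act_dvd_eq_0[of "g j"])
      then show ?thesis using True by (simp add: act_vec_add)
    qed (use that I(2) in auto)
    show "W = range (\<lambda>h. \<Sum>k\<in>I. act ((h(j := h i)) k) (z k))"
    proof (intro equalityI subsetI)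
      fix w assume "w \<in> W"
      then obtain h where h: "w = (\<Sum>k\<in>I. act (h k) (z k))" using I(3) by blast
      \<comment> \<open>Chinese remainders: \<open>t * g j\<close> is 1 modulo \<open>g i\<close>
        and 0 modulo \<open>g j\<close>, and \<open>s * g i\<close> the other way round. Hence
        \<open>r\<close> acts like \<open>h i\<close> on \<open>z i\<close> and like
        \<open>h j\<close> on \<open>z j\<close>.\<close>
      define r where "r = h i * (t * g j) + h j * (s * g i)"
      have "act r (z i) = act (h i) (z i)"
      proof -
        have tg: "t * g j = 1 - s * g i" using st by (simp add: eq_diff_eq add.commute)
        have "r = h i + (h j - h i) * s * g i"
          unfolding r_def tg by (simp add: algebra_simps)
        then show ?thesis using I(2) ij by (simp add: act_add act_mult)
      qed
      moreover have "act r (z j) = act (h j) (z j)"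
      proof -
        have sg: "s * g i = 1 - t * g j" using st by (simp add: eq_diff_eq)
        have "r = h j + (h i - h j) * t * g j"
          unfolding r_def sg by (simp add: algebra_simps)
        then show ?thesis using I(2) ij by (simp add: act_add act_mult)
      qed
      ultimately have "w = (\<Sum>k\<in>I. act (((h(i := r))(j := (h(i := r)) i)) k) (z k))"
        unfolding h using ij(3) by (intro sum.cong) auto
      then show "w \<in> range (\<lambda>h. \<Sum>k\<in>I. act ((h(j := h i)) k) (z k))" by blast
    qed (use I(3) in blast)
    fix h k assume "(\<Sum>k\<in>I. act ((h(j := h i)) k) (z k)) = 0" "k \<in> I - {j}"
    note dvd = I(4)[OF this(1)]
    show "(g(i := g i * g j)) k dvd h k"
      using dvd[of i] dvd[of j] dvd[of k] ij \<open>k \<in> I - {j}\<close> comaximal_mult_dvd[OF assms(5)]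
      by (auto split: if_splits)
  qed (use I(1) in simp)
qed

text \<open>A greedy matching: the largest block of either eigenvalue is merged with the largest block of
  the other one.\<close>

lemma merge_blocks:
  assumes "x \<noteq> y" "cyclic_decomposition W I z g" "S \<subseteq> I" "T \<subseteq> I" "S \<inter> T = {}"
    and "\<And>i. i \<in> S \<Longrightarrow> g i = [:- x, 1:] ^ m i" "\<And>i. i \<in> T \<Longrightarrow> g i = [:- y, 1:] ^ m i"
    and "\<And>k. k \<ge> 1 \<Longrightarrow> card {i \<in> S. m i \<ge> k + 1} \<le> card {i \<in> T. m i \<ge> k}"
    and "\<And>k. k \<ge> 1 \<Longrightarrow> card {i \<in> T. m i \<ge> k + 1} \<le> card {i \<in> S. m i \<ge> k}"
  shows "\<exists>I' z' g'. cyclic_decomposition W I' z' g' \<and> I' \<subseteq> I \<and> I - (S \<union> T) \<subseteq> I' \<and>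
    (\<forall>i\<in>I - (S \<union> T). g' i = g i) \<and>
    (\<forall>i\<in>I' \<inter> (S \<union> T). \<exists>a b. g' i = [:- x, 1:] ^ a * [:- y, 1:] ^ b \<and> a \<le> b + 1 \<and> b \<le> a + 1)"
  using assms(2-)
proof (induction "card S" arbitrary: I z g S T)
  case (0 S I z g T)
  have fin: "finite I" using 0 by (auto simp: cyclic_decomposition_def)
  then have "S = {}" "finite T" using 0 by (auto dest: finite_subset)
  \<comment> \<open>With no block left on one side, the counting hypothesis at \<open>k = 1\<close>
    excludes sizes above 1 on the other; a single block of size 1 is balanced against the missing
    one.\<close>
  have "m i \<le> 1" if "i \<in> T" for i
  proof (rule ccontr)
    assume "\<not> m i \<le> 1"
    then have "{i \<in> T. m i \<ge> 1 + 1} \<noteq> {}" using that by auto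
    then have "card {i \<in> T. m i \<ge> 1 + 1} > 0" using \<open>finite T\<close> by (simp add: card_gt_0_iff)
    then show False using "0.prems"(8)[of 1] \<open>S = {}\<close> by simp
  qed
  then have "\<forall>i\<in>I \<inter> (S \<union> T). \<exists>a b. g i = [:- x, 1:] ^ a * [:- y, 1:] ^ b \<and> a \<le> b + 1 \<and> b \<le> a + 1"
    using 0 \<open>S = {}\<close> by (intro ballI exI[of _ 0] exI[of _ "m _"]) auto
  then show ?case using 0 by blast
next
  case (Suc n S I z g T)
  note prems = Suc.prems
  have fin: "finite I" using prems(1) by (auto simp: cyclic_decomposition_def)
  then have finST: "finite S" "finite T" using prems by (auto dest: finite_subset)
  have "S \<noteq> {}" using Suc.hyps(2) by auto
  show ?case
  proof (cases "T = {}")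
    case True
    have "m i \<le> 1" if "i \<in> S" for i
    proof (rule ccontr)
      assume "\<not> m i \<le> 1"
      then have "{i \<in> S. m i \<ge> 1 + 1} \<noteq> {}" using that by auto
      then have "card {i \<in> S. m i \<ge> 1 + 1} > 0" using finST by (simp add: card_gt_0_iff)
      then show False using prems(7)[of 1] True by simp
    qed
    then have "\<forall>i\<in>I \<inter> (S \<union> T). \<exists>a b. g i = [:- x, 1:] ^ a * [:- y, 1:] ^ b \<and> a \<le> b + 1 \<and> b \<le> a + 1"
      using prems True by (intro ballI exI[of _ "m _"] exI[of _ 0]) auto
    then show ?thesis using prems by blast
  next
    case False
    obtain i where i: "i \<in> S" "\<And>k. k \<in> S \<Longrightarrow> m k \<le> m i"
      by (rule finite_max_nat[where m = m, OF finST(1) \<open>S \<noteq> {}\<close>]) (rule that)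
    obtain j where j: "j \<in> T" "\<And>k. k \<in> T \<Longrightarrow> m k \<le> m j"
      by (rule finite_max_nat[where m = m, OF finST(2) False]) (rule that)
    \<comment> \<open>Otherwise the counting hypothesis at \<open>k = m j + 1\<close> would provide
      a block of \<open>T\<close> larger than the largest one.\<close>
    have "m i \<le> m j + 1"
    proof (rule ccontr)
      assume "\<not> ?thesis"
      then have "i \<in> {k \<in> S. m k \<ge> m j + 1 + 1}" "m j + 1 \<ge> 1" using i by auto
      then have "card {k \<in> S. m k \<ge> m j + 1 + 1} > 0" using finST by (auto simp: card_gt_0_iff)
      then have "card {k \<in> T. m k \<ge> m j + 1} > 0" using prems(7)[of "m j + 1"] by simp
      then have "{k \<in> T. m k \<ge> m j + 1} \<noteq> {}" by (rule card_gt_0_iff[THEN iffD1, THEN conjunct1])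
      then show False using j(2) by fastforce
    qed
    have "m j \<le> m i + 1"
    proof (rule ccontr)
      assume "\<not> ?thesis"
      then have "j \<in> {k \<in> T. m k \<ge> m i + 1 + 1}" "m i + 1 \<ge> 1" using j by auto
      then have "card {k \<in> T. m k \<ge> m i + 1 + 1} > 0" using finST by (auto simp: card_gt_0_iff)
      then have "card {k \<in> S. m k \<ge> m i + 1} > 0" using prems(8)[of "m i + 1"] by simp
      then have "{k \<in> S. m k \<ge> m i + 1} \<noteq> {}" by (rule card_gt_0_iff[THEN iffD1, THEN conjunct1])
      then show False using i(2) by fastforce
    qed
    have ij: "i \<in> I" "j \<in> I" "i \<noteq> j" using i j prems by auto
    have com: "comaximal (g i) (g j)"
      using prems(5)[OF i(1)] prems(6)[OF j(1)] comaximal_powers[OF comaximal_linear[OF assms(1)]]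
      by simp
    let ?I = "I - {j}" and ?z = "z(i := z i + z j)" and ?g = "g(i := g i * g j)"
    let ?S = "S - {i}" and ?T = "T - {j}"
    have dec: "cyclic_decomposition W ?I ?z ?g"
      by (rule merge_cyclic_summands[OF prems(1) ij com])
    have cardX: "card {k \<in> ?S. m k \<ge> l} = card {k \<in> S. m k \<ge> l} - (if m i \<ge> l then 1 else 0)" for l
    proof -
      have "{k \<in> ?S. m k \<ge> l} = {k \<in> S. m k \<ge> l} - {i}" by auto
      then show ?thesis using i(1) finST by (auto simp: card_Diff_singleton_if)
    qed
    have cardY: "card {k \<in> ?T. m k \<ge> l} = card {k \<in> T. m k \<ge> l} - (if m j \<ge> l then 1 else 0)" for l
    proof -
      have "{k \<in> ?T. m k \<ge> l} = {k \<in> T. m k \<ge> l} - {j}" by auto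
      then show ?thesis using j(1) finST by (auto simp: card_Diff_singleton_if)
    qed
    have emptyX: "{k \<in> S. m k \<ge> l} = {}" if "\<not> m i \<ge> l" for l
      using i(2) that by fastforce
    have emptyY: "{k \<in> T. m k \<ge> l} = {}" if "\<not> m j \<ge> l" for l
      using j(2) that by fastforce
    have "\<exists>I' z' g'. cyclic_decomposition W I' z' g' \<and> I' \<subseteq> ?I \<and> ?I - (?S \<union> ?T) \<subseteq> I' \<and>
      (\<forall>k\<in>?I - (?S \<union> ?T). g' k = ?g k) \<and>
      (\<forall>k\<in>I' \<inter> (?S \<union> ?T). \<exists>a b. g' k = [:- x, 1:] ^ a * [:- y, 1:] ^ b \<and> a \<le> b + 1 \<and> b \<le> a + 1)"
    proof (rule Suc.hyps(1)[OF _ dec])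
      show "n = card ?S" using Suc.hyps(2) i(1) finST by simp
      \<comment> \<open>Either removing the two largest blocks lowers both counts by one, or the
        count on the left was already zero.\<close>
      show "card {k \<in> ?S. m k \<ge> l + 1} \<le> card {k \<in> ?T. m k \<ge> l}" if "l \<ge> 1" for l
      proof (cases "m i \<ge> l + 1")
        case True
        then have "m j \<ge> l" using \<open>m i \<le> m j + 1\<close> by simp
        then show ?thesis using prems(7)[OF that] True by (simp only: cardX cardY)
      next
        case False
        show ?thesis by (simp only: cardX emptyX[OF False] card.empty diff_0_eq_0 le0)
      qed
      show "card {k \<in> ?T. m k \<ge> l + 1} \<le> card {k \<in> ?S. m k \<ge> l}" if "l \<ge> 1" for l
      proof (cases "m j \<ge> l + 1")
        case True
        then have "m i \<ge> l" using \<open>m j \<le> m i + 1\<close> by simp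
        then show ?thesis using prems(8)[OF that] True by (simp only: cardX cardY)
      next
        case False
        show ?thesis by (simp only: cardY emptyY[OF False] card.empty diff_0_eq_0 le0)
      qed
    qed (use prems(2-6) ij i(1) j(1) in auto)
    then obtain I' z' g' where I': "cyclic_decomposition W I' z' g'" "I' \<subseteq> ?I" "?I - (?S \<union> ?T) \<subseteq> I'"
      "\<And>k. k \<in> ?I - (?S \<union> ?T) \<Longrightarrow> g' k = ?g k"
      "\<And>k. k \<in> I' \<inter> (?S \<union> ?T) \<Longrightarrow>
         \<exists>a b. g' k = [:- x, 1:] ^ a * [:- y, 1:] ^ b \<and> a \<le> b + 1 \<and> b \<le> a + 1"
      by metis
    have "I' \<subseteq> I" using I'(2) by blast
    moreover have "I - (S \<union> T) \<subseteq> I'" using I'(3) i j by blast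
    moreover have "\<forall>k\<in>I - (S \<union> T). g' k = g k"
    proof
      fix k assume "k \<in> I - (S \<union> T)"
      then have "k \<noteq> i" "k \<in> ?I - (?S \<union> ?T)" using i(1) j(1) by auto
      then show "g' k = g k" using I'(4)[OF \<open>k \<in> ?I - (?S \<union> ?T)\<close>] by simp
    qed
    moreover have "\<exists>a b. g' k = [:- x, 1:] ^ a * [:- y, 1:] ^ b \<and> a \<le> b + 1 \<and> b \<le> a + 1"
      if "k \<in> I' \<inter> (S \<union> T)" for k
    proof (cases "k = i")
      case True
      have "i \<in> ?I - (?S \<union> ?T)" using i(1) ij prems(4) by blast
      then have "g' i = g i * g j" using I'(4)[OF \<open>i \<in> ?I - (?S \<union> ?T)\<close>] by simp
      then show ?thesis
        using True prems(5)[OF i(1)] prems(6)[OF j(1)] \<open>m i \<le> m j + 1\<close> \<open>m j \<le> m i + 1\<close> by auto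
    next
      case False
      then show ?thesis using I'(2,5) that by blast
    qed
    ultimately show ?thesis using I'(1) by blast
  qed
qed

text \<open>The condition under which the linear factors can be ordered alternately. An exponent 0
  stands for a missing block, and \<open>x = y\<close> is allowed.\<close>

definition balanced :: "'f \<Rightarrow> 'f \<Rightarrow> 'f poly \<Rightarrow> bool" where
  "balanced x y g \<longleftrightarrow> (\<exists>a b. g = [:- x, 1:] ^ a * [:- y, 1:] ^ b \<and> a \<le> b + 1 \<and> b \<le> a + 1)"

text \<open>Cutting the exponent into halves that differ by at most 1 makes every Jordan block
  balanced when the two values coincide.\<close>

lemma balanced_power: "balanced x x ([:- x, 1:] ^ n)"
proof -
  have "[:- x, 1:] ^ n = [:- x, 1:] ^ (n - n div 2) * [:- x, 1:] ^ (n div 2)"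
    by (simp flip: power_add)
  then show ?thesis unfolding balanced_def
    by (intro exI[of _ "n - n div 2"] exI[of _ "n div 2"]) auto
qed

text \<open>The decomposition being modified is kept apart from the original Jordan decomposition:
  the numbers \<open>nk\<close> are read off the latter, whereas the second of the two pairs is
  merged when the blocks of the first have already been changed.\<close>

lemma merge_eigenvalue_pair:
  assumes dec: "cyclic_decomposition UNIV I z g"
    and jordan: "cyclic_decomposition UNIV I0 z0 (\<lambda>i. [:- l i, 1:] ^ m i)"
    and I0: "{i \<in> I0. l i = x \<or> l i = y} \<subseteq> I"
    and g: "\<And>i. i \<in> I0 \<Longrightarrow> l i = x \<or> l i = y \<Longrightarrow> g i = [:- l i, 1:] ^ m i"
    and int: "x \<noteq> y \<Longrightarrow> intertwined 1 (nk scale U x) (nk scale U y)"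
  shows "\<exists>I' z' g'. cyclic_decomposition UNIV I' z' g' \<and> I' \<subseteq> I \<and>
    I - {i \<in> I0. l i = x \<or> l i = y} \<subseteq> I' \<and>
    (\<forall>i\<in>I - {i \<in> I0. l i = x \<or> l i = y}. g' i = g i) \<and>
    (\<forall>i\<in>I' \<inter> {i \<in> I0. l i = x \<or> l i = y}. balanced x y (g' i))"
proof (cases "x = y")
  case True
  have "\<forall>i\<in>I \<inter> {i \<in> I0. l i = x \<or> l i = y}. balanced x y (g i)"
    using g True by (auto simp: balanced_power)
  then show ?thesis using dec by blast
next
  case False
  define S T where "S = {i \<in> I0. l i = x}" and "T = {i \<in> I0. l i = y}"
  have XY: "{i \<in> I0. l i = x \<or> l i = y} = S \<union> T" by (auto simp: S_def T_def)
  have nkX: "nk scale U x k = card {i \<in> S. m i \<ge> k}" if "k \<ge> 1" for k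
    using nk_eq_card_blocks[OF jordan that, of x] by (simp add: S_def conj_assoc)
  have nkY: "nk scale U y k = card {i \<in> T. m i \<ge> k}" if "k \<ge> 1" for k
    using nk_eq_card_blocks[OF jordan that, of y] by (simp add: T_def conj_assoc)
  have "\<exists>I' z' g'. cyclic_decomposition UNIV I' z' g' \<and> I' \<subseteq> I \<and> I - (S \<union> T) \<subseteq> I' \<and>
    (\<forall>i\<in>I - (S \<union> T). g' i = g i) \<and>
    (\<forall>i\<in>I' \<inter> (S \<union> T). \<exists>a b. g' i = [:- x, 1:] ^ a * [:- y, 1:] ^ b \<and> a \<le> b + 1 \<and> b \<le> a + 1)"
  proof (rule merge_blocks[OF False dec, of S T m])
    show "card {i \<in> S. m i \<ge> k + 1} \<le> card {i \<in> T. m i \<ge> k}" if "k \<ge> 1" for k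
    proof -
      have "nk scale U x (k + 1) \<le> nk scale U y k"
        using int[OF False] that by (simp add: intertwined_def)
      then show ?thesis using nkX[of "k + 1"] nkY[OF that] by simp
    qed
    show "card {i \<in> T. m i \<ge> k + 1} \<le> card {i \<in> S. m i \<ge> k}" if "k \<ge> 1" for k
    proof -
      have "nk scale U y (k + 1) \<le> nk scale U x k"
        using int[OF False] that by (simp add: intertwined_def)
      then show ?thesis using nkY[of "k + 1"] nkX[OF that] by simp
    qed
  qed (use I0 g False in \<open>auto simp: S_def T_def\<close>)
  then show ?thesis unfolding XY balanced_def .
qed

text \<open>Since the pairs have no common value, merging the blocks of the first leaves those of
  the second as they were, and conversely.\<close>

theorem balanced_decomposition:
  assumes ann: "\<And>w. act (\<Prod>a\<leftarrow>as. [:- a, 1:]) w = 0" "set as \<subseteq> {x, y, x', y'}"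
    and disj: "{x, y} \<inter> {x', y'} = {}"
    and int: "x \<noteq> y \<Longrightarrow> intertwined 1 (nk scale U x) (nk scale U y)"
      "x' \<noteq> y' \<Longrightarrow> intertwined 1 (nk scale U x') (nk scale U y')"
  obtains I z g where "cyclic_decomposition UNIV I z g"
    "\<And>i. i \<in> I \<Longrightarrow> balanced x y (g i) \<or> balanced x' y' (g i)"
proof -
  have "invariant UNIV" by (simp add: invariant_def)
  then obtain I z l m where J: "cyclic_decomposition UNIV I z (\<lambda>i. [:- l i, 1:] ^ m i)"
    "\<And>i. i \<in> I \<Longrightarrow> l i \<in> set as"
    using jordan_decomposition[of UNIV as] ann(1) by metis
  let ?A = "{i \<in> I. l i = x \<or> l i = y}" and ?B = "{i \<in> I. l i = x' \<or> l i = y'}"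
  have AB: "?A \<inter> ?B = {}" "I = ?A \<union> ?B" using disj J(2) ann(2) by fastforce+
  have "\<exists>I1 z1 g1. cyclic_decomposition UNIV I1 z1 g1 \<and> I1 \<subseteq> I \<and> I - ?A \<subseteq> I1 \<and>
      (\<forall>i\<in>I - ?A. g1 i = [:- l i, 1:] ^ m i) \<and> (\<forall>i\<in>I1 \<inter> ?A. balanced x y (g1 i))"
    by (rule merge_eigenvalue_pair[OF J(1) J(1)]) (use int(1) in auto)
  then obtain I1 z1 g1 where I1: "cyclic_decomposition UNIV I1 z1 g1" "I1 \<subseteq> I" "I - ?A \<subseteq> I1"
    "\<forall>i\<in>I - ?A. g1 i = [:- l i, 1:] ^ m i" "\<forall>i\<in>I1 \<inter> ?A. balanced x y (g1 i)"
    by (elim exE conjE) (rule that)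
  have "?B \<subseteq> I1" using AB I1(3) by blast
  moreover have "g1 i = [:- l i, 1:] ^ m i" if "i \<in> I" "l i = x' \<or> l i = y'" for i
    using that AB I1(4) by blast
  ultimately have "\<exists>I2 z2 g2. cyclic_decomposition UNIV I2 z2 g2 \<and> I2 \<subseteq> I1 \<and> I1 - ?B \<subseteq> I2 \<and>
      (\<forall>i\<in>I1 - ?B. g2 i = g1 i) \<and> (\<forall>i\<in>I2 \<inter> ?B. balanced x' y' (g2 i))"
    by (intro merge_eigenvalue_pair[OF I1(1) J(1)]) (use int(2) in auto)
  then obtain I2 z2 g2 where I2: "cyclic_decomposition UNIV I2 z2 g2" "I2 \<subseteq> I1" "I1 - ?B \<subseteq> I2"
    "\<forall>i\<in>I1 - ?B. g2 i = g1 i" "\<forall>i\<in>I2 \<inter> ?B. balanced x' y' (g2 i)"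
    by (elim exE conjE) (rule that)
  have "balanced x y (g2 i) \<or> balanced x' y' (g2 i)" if "i \<in> I2" for i
  proof (cases "i \<in> ?B")
    case False
    then have "i \<in> I1 \<inter> ?A" using that I2(2) I1(2) AB by blast
    then show ?thesis using I1(5) I2(4) False by auto
  qed (use that I2(5) in blast)
  then show thesis using that I2(1) by blast
qed

end

section \<open>Newton polynomials and alternating products\<close>

lemma degree_prod_linear:
  "Polynomial.degree (\<Prod>l<n. [:- d l :: 'f::field, 1:]) = n"
  "Polynomial.coeff (\<Prod>l<n. [:- d l :: 'f::field, 1:]) n = 1"
proof -
  show deg: "Polynomial.degree (\<Prod>l<n. [:- d l :: 'f, 1:]) = n"
    by (subst degree_prod_eq_sum_degree) auto
  have "Polynomial.lead_coeff (\<Prod>l<n. [:- d l :: 'f, 1:]) = 1"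
    by (simp add: lead_coeff_prod)
  then show "Polynomial.coeff (\<Prod>l<n. [:- d l :: 'f, 1:]) n = 1"
    by (simp only: deg)
qed

lemma coeff_newton_sum_ge:
  fixes d c :: "nat \<Rightarrow> 'f::field"
  assumes "n \<le> k"
  shows "Polynomial.coeff (\<Sum>j<n. Polynomial.smult (c j) (\<Prod>l<j. [:- d l, 1:])) k = 0"
  using assms by (auto simp: Polynomial.coeff_sum coeff_eq_0 degree_prod_linear intro!: sum.neutral)

text \<open>The sum has degree less than \<open>n\<close>, so being divisible by a polynomial of
  degree \<open>n\<close> makes it zero. The \<open>j\<close>-th Newton polynomial is monic of
  degree \<open>j\<close>, hence the coefficients vanish from the top down.\<close>

lemma newton_independent:
  fixes d c :: "nat \<Rightarrow> 'f::field"
  assumes "(\<Prod>l<n. [:- d l, 1:]) dvd (\<Sum>j<n. Polynomial.smult (c j) (\<Prod>l<j. [:- d l, 1:]))"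
    and "j < n"
  shows "c j = 0"
proof -
  let ?s = "\<lambda>n. \<Sum>j<n. Polynomial.smult (c j) (\<Prod>l<j. [:- d l, 1:])"
  have "?s n = 0"
  proof (rule ccontr)
    assume "?s n \<noteq> 0"
    then have "n \<le> Polynomial.degree (?s n)"
      using dvd_imp_degree_le[OF assms(1)] by (simp add: degree_prod_linear)
    then have "Polynomial.lead_coeff (?s n) = 0" by (rule coeff_newton_sum_ge)
    then show False using \<open>?s n \<noteq> 0\<close> by simp
  qed
  then show ?thesis using \<open>j < n\<close>
  proof (induction n)
    case (Suc n)
    have "Polynomial.coeff (?s (Suc n)) n = c n"
      by (simp add: coeff_newton_sum_ge degree_prod_linear)
    then have "c n = 0" unfolding Suc.prems(1) by simp
    then show ?case using Suc by (cases "j = n") auto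
  qed simp
qed

lemma prod_alternating:
  fixes u w :: "'a::comm_monoid_mult"
  shows "(\<Prod>l<2 * n. if even l then u else w) = u ^ n * w ^ n"
    and "(\<Prod>l<Suc (2 * n). if even l then u else w) = u ^ Suc n * w ^ n"
proof -
  show *: "(\<Prod>l<2 * n. if even l then u else w) = u ^ n * w ^ n"
    by (induction n) (simp_all add: ac_simps)
  show "(\<Prod>l<Suc (2 * n). if even l then u else w) = u ^ Suc n * w ^ n"
    unfolding prod.lessThan_Suc * by (simp add: ac_simps)
qed

text \<open>If one of the two factors is in surplus, the alternating sequence has to begin and end
  with it; this is why either of \<open>x\<close> and \<open>y\<close> may come first.\<close>

lemma (in endomorphism) balanced_alternating:
  assumes "balanced x y g"
  obtains n :: nat where "g = (\<Prod>l<n. [:- (if even l then x else y), 1:])"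
  | n :: nat where "g = (\<Prod>l<n. [:- (if even l then y else x), 1:])"
proof -
  obtain a b where g: "g = [:- x, 1:] ^ a * [:- y, 1:] ^ b" "a \<le> b + 1" "b \<le> a + 1"
    using assms by (auto simp: balanced_def)
  have dist: "[:- (if even l then s else t), 1:] = (if even l then [:- s, 1:] else [:- t, 1:])"
    for l :: nat and s t :: 'f by simp
  consider "a = b" | "a = Suc b" | "b = Suc a" using g by linarith
  then show thesis
  proof cases
    case 1
    then show thesis using that(1)[of "2 * a"] g(1) by (simp only: dist prod_alternating)
  next
    case 2
    then show thesis using that(1)[of "Suc (2 * b)"] g(1) by (simp only: dist prod_alternating)
  next
    case 3
    then have "g = [:- y, 1:] ^ Suc a * [:- x, 1:] ^ a" using g(1) by (simp only: mult.commute)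
    then show thesis using that(2)[of "Suc (2 * a)"] by (simp only: dist prod_alternating)
  qed
qed

section \<open>Construction of the two summands\<close>

context endomorphism
begin

text \<open>The vectors \<open>e (i, j)\<close> form a basis in which \<open>U\<close> is lower bidiagonal, with alternating
  diagonal entries \<open>\<alpha> i - \<beta> i\<close> and \<open>\<alpha>' i - \<beta>' i\<close>. The summand \<open>A\<close> takes every other subdiagonal
  entry, and \<open>- B\<close> the remaining ones, so that both are block diagonal with triangular
  blocks of size 2 having the two roots on the diagonal.\<close>

lemma difference_if_alternating:
  fixes N :: "nat \<Rightarrow> nat"
  assumes dec: "cyclic_decomposition UNIV I z g"
    and g: "\<And>i. i \<in> I \<Longrightarrow> g i = (\<Prod>l<N i. [:- (if even l then \<alpha> i - \<beta> i else \<alpha>' i - \<beta>' i), 1:])"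
    and p: "\<And>i. i \<in> I \<Longrightarrow> p = [:- \<alpha> i, 1:] * [:- \<alpha>' i, 1:]"
    and q: "\<And>i. i \<in> I \<Longrightarrow> q = [:- \<beta> i, 1:] * [:- \<beta>' i, 1:]"
  shows "pq_difference scale UNIV p q U"
proof -
  have I: "finite I" "\<And>i. i \<in> I \<Longrightarrow> act (g i) (z i) = 0"
    "\<And>x. \<exists>h. x = (\<Sum>i\<in>I. act (h i) (z i))"
    "\<And>h i. (\<Sum>i\<in>I. act (h i) (z i)) = 0 \<Longrightarrow> i \<in> I \<Longrightarrow> g i dvd h i"
    using dec by (auto simp: cyclic_decomposition_def set_eq_iff image_iff)
  define d where "d i l = (if even l then \<alpha> i - \<beta> i else \<alpha>' i - \<beta>' i)" for i and l :: nat
  define \<pi> where "\<pi> i j = (\<Prod>l<j. [:- d i l, 1:])" for i and j :: nat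
  define e where "e = (\<lambda>(i, j). act (\<pi> i j) (z i))"
  define K where "K = Sigma I (\<lambda>i. {..<N i})"
  have "finite K" using I(1) by (auto simp: K_def)
  have g_eq: "g i = \<pi> i (N i)" if "i \<in> I" for i
    using g[OF that] by (simp add: \<pi>_def d_def)
  \<comment> \<open>Just past the end of a block the vector is zero, so \<open>U_e\<close> holds at
    the last index without a boundary case.\<close>
  have e_N: "e (i, N i) = 0" if "i \<in> I" for i
    using I(2)[OF that] by (simp add: e_def g_eq[OF that])
  have U_e: "U (e (i, j)) = scale (d i j) (e (i, j)) + e (i, Suc j)" for i j
    by (simp add: e_def \<pi>_def act_mult act_linear_factor zero mult.commute[of _ "[:_, _:]"]
        del: act_pCons mult_pCons_left mult_pCons_right)
  have indep: "c k = 0" if sum: "(\<Sum>k\<in>K. scale (c k) (e k)) = 0" and "k \<in> K" for c k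
  proof -
    obtain i j where k: "k = (i, j)" "i \<in> I" "j < N i" using \<open>k \<in> K\<close> by (auto simp: K_def)
    have "(\<Sum>i\<in>I. act ((\<lambda>i. \<Sum>j<N i. Polynomial.smult (c (i, j)) (\<pi> i j)) i) (z i)) = 0"
      using sum I(1) unfolding K_def
      by (simp add: sum.Sigma e_def act_sum act_smult case_prod_beta')
    from I(4)[OF this k(2)] show ?thesis
      using newton_independent[of "d i" "N i" "\<lambda>j. c (i, j)" j] k g_eq[OF k(2)] by (simp add: \<pi>_def)
  qed
  have inj: "inj_on e K" and ind: "independent (e ` K)"
    by (rule independent_family[OF \<open>finite K\<close>]; use indep in blast)+
  have mem: "e (i, j) \<in> span (e ` K)" if "i \<in> I" "j \<le> N i" for i j
    using that e_N by (cases "j = N i") (auto simp: K_def span_zero intro!: span_base)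
  have "U x \<in> span (e ` K)" if "x \<in> span (e ` K)" for x
  proof -
    have "U ` span (e ` K) = span (U ` e ` K)"
      by (simp add: span_image)
    also have "\<dots> \<subseteq> span (e ` K)"
    proof (rule span_minimal)
      show "U ` e ` K \<subseteq> span (e ` K)"
      proof clarify
        fix i j assume "(i, j) \<in> K"
        then have "i \<in> I" "j \<le> N i" "Suc j \<le> N i" by (auto simp: K_def)
        then show "U (e (i, j)) \<in> span (e ` K)"
          unfolding U_e by (intro span_add span_scale mem)
      qed
    qed simp
    finally show ?thesis using that by blast
  qed
  then have "invariant (span (e ` K))" by (auto simp: invariant_def)
  moreover have "z i \<in> span (e ` K)" if "i \<in> I" for i
    using mem[OF that, of 0] by (simp add: e_def \<pi>_def)
  ultimately have "(\<Sum>i\<in>I. act (h i) (z i)) \<in> span (e ` K)" for h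
    by (intro span_sum invariant_act)
  then have span: "span (e ` K) = UNIV" using I(3) by (metis UNIV_eq_I)
  define F where "F = (\<lambda>(i, j). if even j then scale (\<alpha> i) (e (i, j)) + e (i, Suc j)
      else scale (\<alpha>' i) (e (i, j)))"
  interpret pair: vector_space_pair scale scale ..
  obtain A where A: "Vector_Spaces.linear scale scale A"
    "\<And>k. k \<in> K \<Longrightarrow> A (e k) = F k"
    using pair.linear_independent_extend[OF ind, of "F \<circ> the_inv_into K e"] inj
    by (auto simp: the_inv_into_f_f)
  define B where "B x = A x - U x" for x
  have B: "Vector_Spaces.linear scale scale B"
    unfolding B_def by (rule pair.linear_compose_sub[OF A(1) linear_axioms])
  interpret A: endomorphism scale Basis A
    using A(1) finite_dimensional_vector_space_axioms by (simp add: endomorphism_def)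
  interpret B: endomorphism scale Basis B
    using B finite_dimensional_vector_space_axioms by (simp add: endomorphism_def)
  have A_even: "A (e (i, j)) = scale (\<alpha> i) (e (i, j)) + e (i, Suc j)"
    and B_even: "B (e (i, j)) = scale (\<beta> i) (e (i, j))" if "i \<in> I" "j < N i" "even j" for i j
  proof -
    show A_e: "A (e (i, j)) = scale (\<alpha> i) (e (i, j)) + e (i, Suc j)"
      using A(2)[of "(i, j)"] that by (simp add: K_def F_def)
    show "B (e (i, j)) = scale (\<beta> i) (e (i, j))"
      using that by (simp add: B_def A_e U_e d_def scale_left_diff_distrib)
  qed
  \<comment> \<open>The index \<open>j = N i\<close>, where both sides vanish, is included because
    the lemma is also applied to the successor of the last index of a block.\<close>
  have A_odd: "A (e (i, j)) = scale (\<alpha>' i) (e (i, j))"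
    and B_odd: "B (e (i, j)) = scale (\<beta>' i) (e (i, j)) - e (i, Suc j)"
    if "i \<in> I" "j \<le> N i" "odd j" for i j
  proof -
    show A_e: "A (e (i, j)) = scale (\<alpha>' i) (e (i, j))"
      using A(2)[of "(i, j)"] that e_N by (cases "j = N i") (simp_all add: K_def F_def A.zero)
    show "B (e (i, j)) = scale (\<beta>' i) (e (i, j)) - e (i, Suc j)"
      using that by (simp add: B_def A_e U_e d_def scale_left_diff_distrib)
  qed
  have B_even': "B (e (i, j)) = scale (\<beta> i) (e (i, j))" if "i \<in> I" "j \<le> N i" "even j" for i j
    using that B_even e_N by (cases "j = N i") (auto simp: B.zero)
  have pA: "A.act p (e k) = 0" if k: "k \<in> K" for k
  proof -
    obtain i j where ij: "k = (i, j)" "i \<in> I" "j < N i" using k by (auto simp: K_def)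
    show ?thesis
    proof (cases "even j")
      case True
      have "A.act p (e k) = A.act [:- \<alpha>' i, 1:] (A.act [:- \<alpha> i, 1:] (e k))"
        by (simp only: p[OF ij(2)] A.act_mult A.act_commute)
      also have "A.act [:- \<alpha> i, 1:] (e k) = e (i, Suc j)"
        using A_even ij True by (simp add: A.act_linear_factor del: A.act_pCons)
      also have "A.act [:- \<alpha>' i, 1:] (e (i, Suc j)) = 0"
        using A_odd[of i "Suc j"] ij True by (simp add: A.act_linear_factor del: A.act_pCons)
      finally show ?thesis .
    next
      case False
      have "A.act p (e k) = A.act [:- \<alpha> i, 1:] (A.act [:- \<alpha>' i, 1:] (e k))"
        by (simp only: p[OF ij(2)] A.act_mult)
      also have "A.act [:- \<alpha>' i, 1:] (e k) = 0"
        using A_odd[of i j] ij False by (simp add: A.act_linear_factor del: A.act_pCons)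
      finally show ?thesis by simp
    qed
  qed
  have qB: "B.act q (e k) = 0" if k: "k \<in> K" for k
  proof -
    obtain i j where ij: "k = (i, j)" "i \<in> I" "j < N i" using k by (auto simp: K_def)
    show ?thesis
    proof (cases "even j")
      case True
      have "B.act q (e k) = B.act [:- \<beta>' i, 1:] (B.act [:- \<beta> i, 1:] (e k))"
        by (simp only: q[OF ij(2)] B.act_mult B.act_commute)
      also have "B.act [:- \<beta> i, 1:] (e k) = 0"
        using B_even ij True by (simp add: B.act_linear_factor del: B.act_pCons)
      finally show ?thesis by simp
    next
      case False
      have "B.act q (e k) = B.act [:- \<beta> i, 1:] (B.act [:- \<beta>' i, 1:] (e k))"
        by (simp only: q[OF ij(2)] B.act_mult)
      also have "B.act [:- \<beta>' i, 1:] (e k) = - e (i, Suc j)"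
        using B_odd[of i j] ij False by (simp add: B.act_linear_factor del: B.act_pCons)
      also have "B.act [:- \<beta> i, 1:] (- e (i, Suc j)) = 0"
        using B_even'[of i "Suc j"] ij False
        by (simp add: B.act_linear_factor B.neg del: B.act_pCons)
      finally show ?thesis .
    qed
  qed
  have "A.act p x = 0" "B.act q x = 0" for x
  proof -
    have "x \<in> span (e ` K)" by (simp add: span)
    then show "A.act p x = 0"
      by (rule module_hom.eq_0_on_span[OF A.act_linear[folded module_hom_iff_linear], rotated])
        (use pA in blast)
    show "B.act q x = 0"
      by (rule module_hom.eq_0_on_span[OF B.act_linear[folded module_hom_iff_linear], rotated,
            OF \<open>x \<in> span (e ` K)\<close>]) (use qB in blast)
  qed
  moreover have "endo_on scale UNIV A" "endo_on scale UNIV B"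
    using A(1) B by (simp_all add: endo_on_UNIV_iff[OF vector_space_axioms])
  moreover have "U x = A x - B x" for x by (simp add: B_def)
  ultimately show ?thesis unfolding pq_difference_def by blast
qed

text \<open>Exchanging \<open>a1\<close> with \<open>a2\<close> or \<open>b1\<close> with
  \<open>b2\<close> does not change \<open>p\<close> or \<open>q\<close>. Hence the roots can be
  relabelled separately for each block, so that its first diagonal entry is \<open>a - b\<close> and
  its second \<open>a' - b'\<close>, whichever pair it belongs to and whichever value comes
  first.\<close>

theorem difference_if_intertwined:
  assumes ann: "\<And>w. act (\<Prod>a\<leftarrow>as. [:- a, 1:]) w = 0"
      "set as \<subseteq> {a1 - b1, a2 - b2, a1 - b2, a2 - b1}"
    and p: "p = [:- a1, 1:] * [:- a2, 1:]" "a1 \<noteq> a2"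
    and q: "q = [:- b1, 1:] * [:- b2, 1:]" "b1 \<noteq> b2"
    and int: "a1 - b1 \<noteq> a2 - b2 \<Longrightarrow> intertwined 1 (nk scale U (a1 - b1)) (nk scale U (a2 - b2))"
      "a1 - b2 \<noteq> a2 - b1 \<Longrightarrow> intertwined 1 (nk scale U (a1 - b2)) (nk scale U (a2 - b1))"
  shows "pq_difference scale UNIV p q U"
proof -
  \<comment> \<open>The two pairs are disjoint: a difference from one and a difference from the
    other have one root in common and differ in the other root.\<close>
  obtain I z g where I: "cyclic_decomposition UNIV I z g"
    "\<And>i. i \<in> I \<Longrightarrow> balanced (a1 - b1) (a2 - b2) (g i) \<or> balanced (a1 - b2) (a2 - b1) (g i)"
    by (rule balanced_decomposition[OF ann _ int]) (use p(2) q(2) in \<open>auto intro: that\<close>)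
  let ?P = "\<lambda>i (n :: nat) a b a' b'. g i = (\<Prod>l<n. [:- (if even l then a - b else a' - b'), 1:]) \<and>
      p = [:- a, 1:] * [:- a', 1:] \<and> q = [:- b, 1:] * [:- b', 1:]"
  have comm: "p = [:- a2, 1:] * [:- a1, 1:]" "q = [:- b2, 1:] * [:- b1, 1:]"
    by (simp_all only: p q mult.commute)
  have "\<forall>i\<in>I. \<exists>w. case w of (n, a, b, a', b') \<Rightarrow> ?P i n a b a' b'"
  proof
    fix i assume "i \<in> I"
    have ex: "\<exists>w. case w of (n, a, b, a', b') \<Rightarrow> ?P i n a b a' b'"
      if "?P i n a b a' b'" for n a b a' b'
      using that by (intro exI[of _ "(n, a, b, a', b')"]) simp
    from I(2)[OF \<open>i \<in> I\<close>] show "\<exists>w. case w of (n, a, b, a', b') \<Rightarrow> ?P i n a b a' b'"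
    proof
      assume "balanced (a1 - b1) (a2 - b2) (g i)"
      then show ?thesis
      proof (cases rule: balanced_alternating)
        case (1 n)
        then show ?thesis using p(1) q(1) by (intro ex conjI)
      next
        case (2 n)
        then show ?thesis using comm by (intro ex conjI)
      qed
    next
      assume "balanced (a1 - b2) (a2 - b1) (g i)"
      then show ?thesis
      proof (cases rule: balanced_alternating)
        case (1 n)
        then show ?thesis using p(1) comm(2) by (intro ex conjI)
      next
        case (2 n)
        then show ?thesis using comm(1) q(1) by (intro ex conjI)
      qed
    qed
  qed
  from bchoice[OF this] obtain w where w: "\<forall>i\<in>I. case w i of (n, a, b, a', b') \<Rightarrow> ?P i n a b a' b'"
    by (elim exE) (rule that)
  have w': "?P i (fst (w i)) (fst (snd (w i))) (fst (snd (snd (w i)))) (fst (snd (snd (snd (w i)))))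
      (snd (snd (snd (snd (w i)))))" if "i \<in> I" for i
    using bspec[OF w that] by (simp only: case_prod_beta)
  show ?thesis
  proof (rule difference_if_alternating[OF I(1)])
    fix i assume "i \<in> I"
    show "g i = (\<Prod>l<fst (w i). [:- (if even l then fst (snd (w i)) - fst (snd (snd (w i)))
        else fst (snd (snd (snd (w i)))) - snd (snd (snd (snd (w i))))), 1:])"
      using w'[OF \<open>i \<in> I\<close>] by (rule conjunct1)
    show "p = [:- fst (snd (w i)), 1:] * [:- fst (snd (snd (snd (w i)))), 1:]"
      using w'[OF \<open>i \<in> I\<close>] by (elim conjE)
    show "q = [:- fst (snd (snd (w i))), 1:] * [:- snd (snd (snd (snd (w i)))), 1:]"
      using w'[OF \<open>i \<in> I\<close>] by (elim conjE)
  qed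
qed

end

section \<open>Necessity: the commutator\<close>

context endomorphism
begin

text \<open>The commutator \<open>f\<close> of \<open>A\<close> and \<open>U = A - B\<close> intertwines \<open>U\<close> with \<open>x + y - U\<close>, hence exchanges
  the generalized eigenspaces for \<open>x\<close> and \<open>y\<close>, and its square is a polynomial in \<open>U\<close> with simple
  roots at \<open>x\<close> and \<open>y\<close>.\<close>

lemma commutator_of_difference:
  fixes a1 a2 b1 b2 :: 'f
  assumes "pq_difference scale UNIV ([:- a1, 1:] * [:- a2, 1:]) ([:- b1, 1:] * [:- b2, 1:]) U"
  defines "x \<equiv> a1 - b1" and "y \<equiv> a2 - b2"
  obtains f where "Vector_Spaces.linear scale scale f"
    "\<And>z. f (U z) + U (f z) = scale (x + y) (f z)"
    "\<And>z. f (f z) = act (([:- x, 1:] * [:- y, 1:]) * ([:- (a1 - b2), 1:] * [:- (a2 - b1), 1:])) z"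
proof -
  obtain A B where AB: "Vector_Spaces.linear scale scale A" "Vector_Spaces.linear scale scale B"
    "\<And>x. U x = A x - B x"
    "\<And>x. poly_endo scale ([:- a1, 1:] * [:- a2, 1:]) A x = 0"
    "\<And>x. poly_endo scale ([:- b1, 1:] * [:- b2, 1:]) B x = 0"
    using assms(1) unfolding pq_difference_def endo_on_UNIV_iff[OF vector_space_axioms] by auto
  interpret A: endomorphism scale Basis A
    using AB(1) finite_dimensional_vector_space_axioms by (simp add: endomorphism_def)
  interpret B: endomorphism scale Basis B
    using AB(2) finite_dimensional_vector_space_axioms by (simp add: endomorphism_def)
  \<comment> \<open>Subtracting a root from \<open>A\<close> and from \<open>B\<close> keeps their
    commutator and turns the quadratic equations into \<open>P^2 = \<alpha> P\<close> and
    \<open>Q^2 = \<beta> Q\<close>, so that every word in \<open>P\<close> and \<open>Q\<close>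
    reduces to an alternating one.\<close>
  define P where "P z = A z - scale a2 z" for z
  define Q where "Q z = B z - scale b2 z" for z
  define \<alpha> \<beta> where "\<alpha> = a1 - a2" and "\<beta> = b1 - b2"
  have PP: "P (P z) = scale \<alpha> (P z)" for z
    using AB(4)[of z] unfolding A.act_mult A.act_linear_factor
    by (simp add: P_def \<alpha>_def A.diff A.scale scale_left_diff_distrib scale_right_diff_distrib
        algebra_simps)
  have QQ: "Q (Q z) = scale \<beta> (Q z)" for z
    using AB(5)[of z] unfolding B.act_mult B.act_linear_factor
    by (simp add: Q_def \<beta>_def B.diff B.scale scale_left_diff_distrib scale_right_diff_distrib
        algebra_simps)
  have P_lin: "P (z + w) = P z + P w" "P (z - w) = P z - P w" "P (scale c z) = scale c (P z)" "P (- z) = - P z"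
    for z w c
    by (simp_all add: P_def A.add A.diff A.scale A.neg scale_right_distrib scale_right_diff_distrib
        scale_left_commute algebra_simps)
  have Q_lin: "Q (z + w) = Q z + Q w" "Q (z - w) = Q z - Q w" "Q (scale c z) = scale c (Q z)" "Q (- z) = - Q z"
    for z w c
    by (simp_all add: Q_def B.add B.diff B.scale B.neg scale_right_distrib scale_right_diff_distrib
        scale_left_commute algebra_simps)
  have U_eq: "U z = P z - Q z + scale y z" for z
    by (simp add: AB(3) P_def Q_def y_def scale_left_diff_distrib)
  have xy: "x = y + \<alpha> - \<beta>" "a1 - b2 = y + \<alpha>" "a2 - b1 = y - \<beta>"
    by (simp_all add: x_def y_def \<alpha>_def \<beta>_def)
  define f where "f z = Q (P z) - P (Q z)" for z
  have f_lin: "Vector_Spaces.linear scale scale f"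
    unfolding Defs.linear_iff[OF vector_space_axioms vector_space_axioms] f_def
    by (simp add: P_lin Q_lin scale_right_diff_distrib)
  then interpret f: Vector_Spaces.linear scale scale f .
  have f_PQ: "f (P z - Q z) + (P (f z) - Q (f z)) = scale (\<alpha> - \<beta>) (f z)" for z
    unfolding f_def
    by (simp add: P_lin Q_lin PP QQ scale_right_diff_distrib scale_right_distrib
        scale_left_distrib scale_left_diff_distrib algebra_simps)
  note f_lin
  moreover have "f (U z) + U (f z) = scale (x + y) (f z)" for z
  proof -
    have "f (U z) + U (f z) =
        (f (P z - Q z) + (P (f z) - Q (f z))) + scale y (f z) + scale y (f z)"
      unfolding U_eq f.add f.scale by (simp only: ac_simps)
    also have "\<dots> = scale (\<alpha> - \<beta> + y + y) (f z)"
      by (simp only: f_PQ scale_left_distrib)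
    also have "\<alpha> - \<beta> + y + y = x + y" by (simp add: xy)
    finally show ?thesis .
  qed
  moreover have "f (f z) = act (([:- x, 1:] * [:- y, 1:]) * ([:- (a1 - b2), 1:] * [:- (a2 - b1), 1:])) z" for z
  proof -
    \<comment> \<open>\<open>T\<close> is \<open>(U - x) * (U - y)\<close>. The product for the
      other pair differs from it by a scalar only, since both pairs have the same sum.\<close>
    define T where "T z = scale \<beta> (P z) + scale \<alpha> (Q z) - P (Q z) - Q (P z)" for z
    have T1: "act ([:- x, 1:] * [:- y, 1:]) z = T z" for z
      unfolding act_mult act_linear_factor U_eq T_def xy
      by (simp add: P_lin Q_lin PP QQ scale_right_diff_distrib scale_right_distrib
          scale_left_distrib scale_left_diff_distrib algebra_simps)
    have T2: "act ([:- (a1 - b2), 1:] * [:- (a2 - b1), 1:]) z = T z - scale (\<alpha> * \<beta>) z" for z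
      unfolding act_mult act_linear_factor U_eq T_def xy
      by (simp add: P_lin Q_lin PP QQ scale_right_diff_distrib scale_right_distrib
          scale_left_distrib scale_left_diff_distrib algebra_simps)
    have "f (f z) = T (T z - scale (\<alpha> * \<beta>) z)"
      unfolding f_def T_def
      by (simp add: P_lin Q_lin PP QQ scale_right_diff_distrib scale_right_distrib
          scale_left_distrib scale_left_diff_distrib algebra_simps)
    then show ?thesis by (simp only: act_mult[of "_ * _" "_ * _"] T1 T2)
  qed
  ultimately show thesis by (rule that)
qed

definition gen_eigenspace :: "'f \<Rightarrow> 'v set" where
  "gen_eigenspace l = {z. \<exists>n. act ([:- l, 1:] ^ n) z = 0}"

lemma invariant_gen_eigenspace: "invariant (gen_eigenspace l)"
proof -
  have mono: "act ([:- l, 1:] ^ (n + m)) z = 0" if "act ([:- l, 1:] ^ n) z = 0" for n m z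
    using act_dvd_eq_0[OF _ that] by (simp add: power_add)
  have "\<exists>n. act ([:- l, 1:] ^ n) (z + w) = 0"
    if "act ([:- l, 1:] ^ n) z = 0" "act ([:- l, 1:] ^ m) w = 0" for z w n m
    using mono[OF that(1), of m] mono[OF that(2), of n]
    by (intro exI[of _ "n + m"]) (simp add: act_vec_add add.commute del: act_pCons)
  moreover have "\<exists>n. act ([:- l, 1:] ^ n) (scale c z) = 0" "\<exists>n. act ([:- l, 1:] ^ n) (U z) = 0"
    if "act ([:- l, 1:] ^ n) z = 0" for z n c
    using that by (auto intro!: exI[of _ n] simp: act_vec_scale act_U zero simp del: act_pCons)
  moreover have "act ([:- l, 1:] ^ 0) 0 = 0" by simp
  ultimately show ?thesis
    unfolding invariant_def gen_eigenspace_def subspace_def by blast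
qed

text \<open>A Bezout identity for \<open>h\<close> and a power of \<open>t - l\<close> killing
  \<open>z\<close> writes \<open>z\<close> as a sum of two vanishing vectors.\<close>

lemma act_inj_on_gen_eigenspace:
  assumes "comaximal [:- l, 1:] h" "z \<in> gen_eigenspace l" "act h z = 0"
  shows "z = 0"
proof -
  obtain n where n: "act ([:- l, 1:] ^ n) z = 0" using assms(2) by (auto simp: gen_eigenspace_def)
  have "comaximal ([:- l, 1:] ^ n) h"
    using comaximal_powers[OF assms(1), of n 1] by simp
  then obtain s t where "s * [:- l, 1:] ^ n + t * h = 1" by (auto simp: comaximal_def)
  then have "act (s * [:- l, 1:] ^ n + t * h) z = z" by simp
  then show ?thesis using n assms(3) by (simp only: act_add act_mult act_vec_0) simp
qed

text \<open>On the generalized eigenspaces \<open>f\<^sup>2\<close> is \<open>U - x\<close>, resp. \<open>U - y\<close>, up to an invertible factor, so the kernels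
  \<open>F w j\<close> of \<open>f\<^sup>j\<close> refine those of the powers of \<open>U - w\<close>; and \<open>f\<close> injects \<open>F y (j + 2) / F y (j + 1)\<close> into
  \<open>F x (j + 1) / F x j\<close>.\<close>

lemma nk_Suc_le_if_intertwiner:
  assumes f: "Vector_Spaces.linear scale scale f"
    and fU: "\<And>z. f (U z) + U (f z) = scale (x + y) (f z)"
    and ff: "\<And>z. f (f z) = act (([:- x, 1:] * [:- y, 1:]) * h) z"
    and com: "comaximal [:- x, 1:] [:- y, 1:]" "comaximal [:- x, 1:] h" "comaximal [:- y, 1:] h"
    and "k \<ge> 1"
  shows "nk scale U y (Suc k) \<le> nk scale U x k"
proof -
  interpret f: Vector_Spaces.linear scale scale f by fact
  have lin_pow: "Vector_Spaces.linear scale scale (f ^^ j)" for j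
    unfolding Defs.linear_iff[OF vector_space_axioms vector_space_axioms]
    by (induction j) (simp_all add: f.add f.scale)
  have pow0: "(f ^^ j) 0 = 0" for j by (induction j) (auto simp: f.zero)
  define F where "F w j = {z \<in> gen_eigenspace w. (f ^^ j) z = 0}" for w j
  have sub: "subspace (F w j)" for w j
  proof -
    interpret fj: Vector_Spaces.linear scale scale "f ^^ j" by (rule lin_pow)
    show ?thesis using invariant_gen_eigenspace[of w]
      by (auto simp: F_def invariant_def subspace_def fj.add fj.scale fj.zero)
  qed
  have step: "act [:- w', 1:] (f z) = - f (act [:- w, 1:] z)" if "w + w' = x + y" for w w' z
  proof -
    have "U (f z) = scale (w + w') (f z) - f (U z)" using fU[of z] that by (simp add: eq_diff_eq add.commute)
    then show ?thesis by (simp add: act_linear_factor f.diff f.scale scale_left_distrib del: act_pCons)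
  qed
  have f_power: "act ([:- w', 1:] ^ k) (f z) = 0"
    if "w + w' = x + y" "act ([:- w, 1:] ^ k) z = 0" for w w' z k
    using that(2)
  proof (induction k arbitrary: z)
    case (Suc k)
    have "act ([:- w', 1:] ^ k) (f (act [:- w, 1:] z)) = 0"
      by (rule Suc.IH) (use Suc.prems in \<open>simp only: power_Suc2 act_mult\<close>)
    then have "act ([:- w', 1:] ^ k) (act [:- w', 1:] (f z)) = 0"
      using act_linear[THEN module_hom.neg[OF module_hom_iff_linear[THEN iffD2]]]
      by (simp add: step[OF that(1)] del: act_pCons)
    then show ?case by (simp only: power_Suc2 act_mult)
  qed (simp add: f.zero)
  have f_gen: "f z \<in> gen_eigenspace w'" if "w + w' = x + y" "z \<in> gen_eigenspace w" for w w' z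
    using that f_power unfolding gen_eigenspace_def by blast
  have F_even: "F w (2 * k) = ker_act ([:- w, 1:] ^ k)"
    if G: "\<And>z. f (f z) = act ([:- w, 1:] * c) z" and c: "comaximal [:- w, 1:] c" for w c k
  proof -
    have pow: "(f ^^ (2 * k)) z = act (([:- w, 1:] * c) ^ k) z" for z
    proof (induction k)
      case (Suc k)
      have "(f ^^ (2 * Suc k)) z = f (f ((f ^^ (2 * k)) z))" by simp
      then show ?case by (simp only: Suc G act_mult power_Suc)
    qed simp
    show ?thesis
    proof (intro equalityI subsetI)
      fix z assume "z \<in> F w (2 * k)"
      then have z: "z \<in> gen_eigenspace w" "act (([:- w, 1:] * c) ^ k) z = 0"
        by (simp_all only: F_def pow mem_Collect_eq)
      then have z2: "act (c ^ k) (act ([:- w, 1:] ^ k) z) = 0"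
        by (simp only: power_mult_distrib mult.commute[of _ "c ^ k"] act_mult)
      have "comaximal [:- w, 1:] (c ^ k)" using comaximal_power_right[OF c] .
      then show "z \<in> ker_act ([:- w, 1:] ^ k)"
        using act_inj_on_gen_eigenspace[OF _ invariant_act[OF invariant_gen_eigenspace z(1)] z2] by simp
    next
      fix z assume "z \<in> ker_act ([:- w, 1:] ^ k)"
      then have z: "act ([:- w, 1:] ^ k) z = 0" by simp
      have "[:- w, 1:] ^ k dvd ([:- w, 1:] * c) ^ k" by (simp only: power_mult_distrib dvd_triv_left)
      then have "act (([:- w, 1:] * c) ^ k) z = 0" using z by (rule act_dvd_eq_0)
      then show "z \<in> F w (2 * k)" using z unfolding F_def pow gen_eigenspace_def by blast
    qed
  qed
  have F_mono: "F w j \<subseteq> F w (Suc j)" for w j by (auto simp: F_def f.zero)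
  have dims: "dim (F w (Suc (Suc j))) + dim (F w' j) \<le> dim (F w (Suc j)) + dim (F w' (Suc j))"
    if w: "w + w' = x + y" for w w' j
  proof -
    let ?S = "F w (Suc (Suc j))" and ?S' = "F w (Suc j)"
    have F_f: "f z \<in> F w' j \<longleftrightarrow> z \<in> F w (Suc j)" if "z \<in> gen_eigenspace w" for z j
      using that f_gen[OF w] by (auto simp: F_def funpow_swap1)
    have genF: "z \<in> gen_eigenspace w" if "z \<in> F w j" for z j using that by (simp add: F_def)
    have "{z \<in> ?S. f z = 0} = {z \<in> ?S'. f z = 0}"
      by (auto simp: F_def funpow_swap1 pow0)
    then have "dim ?S + dim (f ` ?S') = dim ?S' + dim (f ` ?S)"
      using dim_image_add_dim_kernel[OF f sub[of w "Suc j"]]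
        dim_image_add_dim_kernel[OF f sub[of w "Suc (Suc j)"]] by simp
    moreover have eq: "f ` ?S' = f ` ?S \<inter> F w' j"
      using F_f F_mono[of w "Suc j"] genF by blast
    \<comment> \<open>The injection between quotients, without quotients: by \<open>eq\<close>, the
      formula for the dimension of a sum compares the image of \<open>?S\<close> modulo that of
      \<open>?S'\<close> with a subspace of \<open>F w' (Suc j)\<close> modulo
      \<open>F w' j\<close>.\<close>
    moreover have "dim {a + b |a b. a \<in> f ` ?S \<and> b \<in> F w' j} + dim (f ` ?S')
        = dim (f ` ?S) + dim (F w' j)"
      unfolding eq by (intro dim_sums_Int f.subspace_image sub)
    moreover have "{a + b |a b. a \<in> f ` ?S \<and> b \<in> F w' j} \<subseteq> F w' (Suc j)"
    proof clarify
      fix s b assume "s \<in> ?S" "b \<in> F w' j"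
      then have "f s \<in> F w' (Suc j)" "b \<in> F w' (Suc j)" using F_f genF F_mono by blast+
      then show "f s + b \<in> F w' (Suc j)" using sub subspace_add by blast
    qed
    then have "dim {a + b |a b. a \<in> f ` ?S \<and> b \<in> F w' j} \<le> dim (F w' (Suc j))" by (rule dim_subset)
    ultimately show ?thesis by linarith
  qed
  have Fx: "dim (ker_act ([:- x, 1:] ^ k)) = dim (F x (2 * k))" for k
  proof -
    have "F x (2 * k) = ker_act ([:- x, 1:] ^ k)"
    proof (rule F_even)
      show "f (f z) = act ([:- x, 1:] * ([:- y, 1:] * h)) z" for z by (simp only: ff mult.assoc)
    qed (intro comaximal_mult_right com)
    then show ?thesis by simp
  qed
  have Fy: "dim (ker_act ([:- y, 1:] ^ k)) = dim (F y (2 * k))" for k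
  proof -
    have "F y (2 * k) = ker_act ([:- y, 1:] ^ k)"
    proof (rule F_even)
      have "[:- x, 1:] * [:- y, 1:] * h = [:- y, 1:] * ([:- x, 1:] * h)" by (simp only: ac_simps)
      then show "f (f z) = act ([:- y, 1:] * ([:- x, 1:] * h)) z" for z by (simp only: ff)
    qed (intro comaximal_mult_right com comaximal_commute[THEN iffD1, OF com(1)])
    then show ?thesis by simp
  qed
  obtain n where k: "k = Suc n" using \<open>k \<ge> 1\<close> by (cases k) auto
  \<comment> \<open>Write \<open>d w j\<close> for \<open>dim (F w (Suc j)) - dim (F w j)\<close>;
    then \<open>dims\<close> says \<open>d w (j + 1) \<le> d w' j\<close>. One step of
    \<open>U - w\<close> is two steps of \<open>f\<close>, so the claim is about sums of two such
    numbers: \<open>d y (2n+2) \<le> d x (2n+1)\<close>, and the zigzag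
    \<open>d y (2n+3) \<le> d x (2n+2) \<le> d y (2n+1) \<le> d x (2n)\<close>.\<close>
  have "dim (F y (Suc (Suc (Suc (Suc (2 * n)))))) + dim (F x (2 * n))
      \<le> dim (F y (Suc (Suc (2 * n)))) + dim (F x (Suc (Suc (2 * n))))"
    using dims[of y x "2 * n"] dims[of x y "Suc (2 * n)"] dims[of y x "Suc (2 * n)"]
      dims[of y x "Suc (Suc (2 * n))"] by (simp add: add.commute)
  then show ?thesis unfolding nk_eq Fx Fy k by simp
qed

theorem intertwined_if_difference:
  fixes a1 a2 b1 b2 :: 'f
  assumes "pq_difference scale UNIV p q U"
    and "p = [:- a1, 1:] * [:- a2, 1:]" "a1 \<noteq> a2" "q = [:- b1, 1:] * [:- b2, 1:]" "b1 \<noteq> b2"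
    and "a1 - b1 \<noteq> a2 - b2"
  shows "intertwined 1 (nk scale U (a1 - b1)) (nk scale U (a2 - b2))"
proof -
  let ?x = "a1 - b1" and ?y = "a2 - b2" and ?h = "[:- (a1 - b2), 1:] * [:- (a2 - b1), 1:]"
  obtain f where f: "Vector_Spaces.linear scale scale f"
    "\<And>z. f (U z) + U (f z) = scale (?x + ?y) (f z)"
    "\<And>z. f (f z) = act (([:- ?x, 1:] * [:- ?y, 1:]) * ?h) z"
    by (rule commutator_of_difference[OF assms(1)[unfolded assms(2,4)]]) (rule that)
  have ne: "?x \<noteq> ?y" "?y \<noteq> ?x" "?x \<noteq> a1 - b2" "?x \<noteq> a2 - b1" "?y \<noteq> a1 - b2" "?y \<noteq> a2 - b1"
    using assms(3,5,6) by auto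
  have com: "comaximal [:- ?x, 1:] [:- ?y, 1:]" "comaximal [:- ?y, 1:] [:- ?x, 1:]"
    "comaximal [:- ?x, 1:] ?h" "comaximal [:- ?y, 1:] ?h"
    by (intro comaximal_linear comaximal_mult_right ne)+
  have f': "f (U z) + U (f z) = scale (?y + ?x) (f z)"
    "f (f z) = act (([:- ?y, 1:] * [:- ?x, 1:]) * ?h) z" for z
    using f(2,3) by (simp_all only: add.commute[of ?y] mult.commute[of "[:- ?y, 1:]"])
  show ?thesis
    unfolding intertwined_def
    using nk_Suc_le_if_intertwiner[OF f(1) f(2) f(3) com(1,3,4)]
      nk_Suc_le_if_intertwiner[OF f(1) f' com(2,4,3)] by simp
qed

end

section \<open>The symplectic extension\<close>

text \<open>Carries a difference on a subset \<open>W\<close>, where values outside \<open>W\<close>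
  are arbitrary, to a whole type on which the preceding theory applies. The summands are conjugated
  by the linear bijection.\<close>

lemma pq_difference_transport:
  fixes s :: "'f::field \<Rightarrow> 'w::ab_group_add \<Rightarrow> 'w" and t :: "'f \<Rightarrow> 'x::ab_group_add \<Rightarrow> 'x"
  assumes bij: "bij_betw \<Theta> UNIV W"
    and add: "\<And>x y. \<Theta> (x + y) = \<Theta> x + \<Theta> y" and scale: "\<And>c x. \<Theta> (t c x) = s c (\<Theta> x)"
    and h: "\<And>x. \<Theta> (H x) = h (\<Theta> x)" and diff: "pq_difference s W p q h"
  shows "pq_difference t UNIV p q H"
proof -
  obtain u1 u2 where u: "endo_on s W u1" "endo_on s W u2" "\<And>x. x \<in> W \<Longrightarrow> h x = u1 x - u2 x"
    "\<And>x. x \<in> W \<Longrightarrow> poly_endo s p u1 x = 0" "\<And>x. x \<in> W \<Longrightarrow> poly_endo s q u2 x = 0"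
    using diff by (auto simp: pq_difference_def)
  have inj: "x = y" if "\<Theta> x = \<Theta> y" for x y
    using bij that by (auto simp: bij_betw_def inj_def)
  have mem: "\<Theta> x \<in> W" for x using bij by (auto simp: bij_betw_def)
  have zero: "\<Theta> 0 = 0" using add[of 0 0] by simp
  have diff: "\<Theta> (x - y) = \<Theta> x - \<Theta> y" for x y using add[of "x - y" y] by (simp add: eq_diff_eq)
  have sum: "\<Theta> (\<Sum>i\<in>I. g i) = (\<Sum>i\<in>I. \<Theta> (g i))" for g and I :: "nat set"
    by (induction I rule: infinite_finite_induct) (simp_all add: zero add)
  define pull where "pull u x = inv_into UNIV \<Theta> (u (\<Theta> x))" for u x
  have pull: "\<Theta> (pull u x) = u (\<Theta> x)" if "endo_on s W u" for u x
    unfolding pull_def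
    by (rule f_inv_into_f) (use that mem bij in \<open>auto simp: endo_on_def bij_betw_def\<close>)
  have endo: "endo_on t UNIV (pull u)" if u: "endo_on s W u" for u
    unfolding endo_on_def
  proof (intro conjI ballI allI)
    show "pull u (x + y) = pull u x + pull u y" for x y
      using u mem by (intro inj) (simp add: pull[OF u] add endo_on_def)
    show "pull u (t c x) = t c (pull u x)" for c x
      using u mem by (intro inj) (simp add: pull[OF u] scale endo_on_def)
  qed simp
  have poly: "\<Theta> (poly_endo t r (pull u) x) = poly_endo s r u (\<Theta> x)" if u: "endo_on s W u" for r u x
  proof -
    have "\<Theta> ((pull u ^^ i) x) = (u ^^ i) (\<Theta> x)" for i
      by (induction i) (simp_all add: pull[OF u])
    then show ?thesis by (simp add: poly_endo_def sum scale)
  qed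
  have "poly_endo t p (pull u1) x = 0" "poly_endo t q (pull u2) x = 0" for x
    by (rule inj; simp add: poly[OF u(1)] poly[OF u(2)] u(4,5) mem zero)+
  moreover have "H x = pull u1 x - pull u2 x" for x
    by (rule inj) (simp add: h diff pull[OF u(1)] pull[OF u(2)] u(3) mem)
  ultimately show ?thesis
    unfolding pq_difference_def using endo[OF u(1)] endo[OF u(2)] by blast
qed

context endomorphism
begin

text \<open>The transpose of \<open>U\<close>, carried to the space itself by
  \<open>basis_pairing\<close>: the coordinates of \<open>transposed x\<close> are the values at the
  basis of the functional that pairs \<open>x\<close> with \<open>U y\<close>.\<close>

definition transposed :: "'v \<Rightarrow> 'v" where
  "transposed x = (\<Sum>b\<in>Basis. scale (basis_pairing x (U b)) b)"

lemma basis_pairing_transposed: "basis_pairing (transposed x) y = basis_pairing x (U y)"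
proof -
  have "Vector_Spaces.linear scale (*) (\<lambda>y. basis_pairing x (U y))"
    by (simp add: Defs.linear_iff[OF vector_space_axioms vector_space_field] basis_pairing_linear
        add scale)
  from linear_functional_eq_basis_pairing[OF this] show ?thesis
    by (metis transposed_def)
qed

lemma linear_transposed: "Vector_Spaces.linear scale scale transposed"
  unfolding Defs.linear_iff[OF vector_space_axioms vector_space_axioms] transposed_def
  by (simp add: basis_pairing_linear scale_left_distrib sum.distrib scale_sum_right)

interpretation transposed: endomorphism scale Basis transposed
  using linear_transposed finite_dimensional_vector_space_axioms by (simp add: endomorphism_def)

lemma basis_pairing_transposed_act:
  "basis_pairing (transposed.act h x) y = basis_pairing x (act h y)"
proof (induction h arbitrary: x y rule: pCons_induct)
  case 0
  show ?case by simp
next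
  case (pCons a h)
  show ?case
    by (simp add: basis_pairing_linear basis_pairing_transposed pCons.IH act_U)
qed

lemma dim_ker_act_transposed: "dim (transposed.ker_act h) = dim (ker_act h)"
  unfolding ker_act_def transposed.ker_act_def
  by (rule dim_kernel_adjoint[OF act_linear transposed.act_linear basis_pairing_transposed_act])

lemma intertwined_if_h_ext_difference:
  fixes a1 a2 b1 b2 :: 'f
  assumes diff: "pq_difference (ext_scale scale) (ext_space scale) p q (h_ext U)"
    and pq: "p = [:- a1, 1:] * [:- a2, 1:]" "a1 \<noteq> a2" "q = [:- b1, 1:] * [:- b2, 1:]" "b1 \<noteq> b2"
    and "a1 - b1 \<noteq> a2 - b2"
  shows "intertwined 1 (nk scale U (a1 - b1)) (nk scale U (a2 - b2))"
proof -
  interpret VV: finite_dimensional_vector_space_prod scale scale Basis Basis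
    by unfold_locales
  define H where "H = map_prod U transposed"
  have H_linear: "Vector_Spaces.linear VV.scale VV.scale H"
    unfolding Defs.linear_iff[OF VV.p.vector_space_axioms VV.p.vector_space_axioms]
    by (auto simp: H_def VV.scale_def add scale transposed.add transposed.scale)
  interpret H: endomorphism VV.scale VV.Basis_pair H
    using H_linear VV.p.finite_dimensional_vector_space_axioms by (simp add: endomorphism_def)
  have H_apply: "H (x, y) = (U x, transposed y)" for x y by (simp add: H_def)
  have H_act: "H.act h (x, y) = (act h x, transposed.act h y)" for h x y
    by (induction h rule: pCons_induct) (simp_all add: H_apply VV.scale_prod zero_prod_def)
  have "dim (ker_act h) + dim (ker_act h) = VV.p.dim (H.ker_act h)" for h
  proof -
    have "H.ker_act h = ker_act h \<times> transposed.ker_act h"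
      by (auto simp: H_act zero_prod_def)
    then show ?thesis
      by (simp add: VV.dim_Times subspace_ker_act transposed.subspace_ker_act dim_ker_act_transposed)
  qed
  then have nk: "nk VV.scale H l k = 2 * nk scale U l k" for l k
    unfolding nk_eq H.nk_eq by (metis diff_mult_distrib2 mult_2)
  \<comment> \<open>This isomorphism carries \<open>H\<close> to \<open>h_ext U\<close>, the second
    component being sent to the functional it represents.\<close>
  define \<Theta> where "\<Theta> = map_prod (\<lambda>x :: 'v. x) basis_pairing"
  have inj: "x = y" if "basis_pairing x = basis_pairing y" for x y
  proof -
    have "basis_pairing (x - y) z = 0" for z
      using basis_pairing_linear(1)[of "x - y" y z] that by simp
    then show ?thesis using basis_pairing_nondegenerate[of "x - y"] by simp
  qed
  have "pq_difference VV.scale UNIV p q H"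
  proof (rule pq_difference_transport[OF _ _ _ _ diff])
    have "basis_pairing x \<in> dual_space scale" for x
      using linear_basis_pairing by (simp add: dual_space_def)
    moreover have "\<exists>x. \<phi> = basis_pairing x" if "\<phi> \<in> dual_space scale" for \<phi>
      using linear_functional_eq_basis_pairing that by (auto simp: dual_space_def)
    ultimately show "bij_betw \<Theta> UNIV (ext_space scale)"
      using inj by (auto simp: bij_betw_def \<Theta>_def ext_space_def inj_def image_iff)
    show "\<Theta> (x + y) = \<Theta> x + \<Theta> y" for x y
      by (cases x; cases y) (simp add: \<Theta>_def fun_eq_iff basis_pairing_linear)
    show "\<Theta> (VV.scale c x) = ext_scale scale c (\<Theta> x)" for c x
      by (cases x) (simp add: \<Theta>_def VV.scale_def ext_scale_def fun_eq_iff basis_pairing_linear)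
    show "\<Theta> (H x) = h_ext U (\<Theta> x)" for x
      by (cases x) (simp add: \<Theta>_def H_def h_ext_def fun_eq_iff basis_pairing_transposed)
  qed
  from H.intertwined_if_difference[OF this pq assms(6)] show ?thesis
    by (simp add: intertwined_def nk)
qed

end

lemma sum_fun_apply: "(\<Sum>i\<in>I. f i) y = (\<Sum>i\<in>I. f i y)"
  by (induction I rule: infinite_finite_induct) simp_all

lemma poly_endo_h_ext:
  assumes "\<phi> \<in> dual_space s" "vector_space s"
  shows "poly_endo (ext_scale s) r (h_ext u) (x, \<phi>) = (poly_endo s r u x, \<lambda>y. \<phi> (poly_endo s r u y))"
proof -
  interpret \<phi>: Vector_Spaces.linear s "(*)" \<phi> using assms(1) by (simp add: dual_space_def)
  have pow: "(h_ext u ^^ i) (x, \<phi>) = ((u ^^ i) x, \<lambda>y. \<phi> ((u ^^ i) y))" for i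
    by (induction i) (simp_all add: h_ext_def fun_eq_iff funpow_swap1)
  show ?thesis
    by (rule prod_eqI)
      (auto simp: poly_endo_def pow ext_scale_def fst_sum snd_sum fun_eq_iff sum_fun_apply
        \<phi>.sum \<phi>.scale)
qed

lemma symplectic_difference_if_difference:
  assumes s: "vector_space s" and v: "Vector_Spaces.linear s s v" and diff: "pq_difference s UNIV p q v"
  shows "symplectic_pq_difference (ext_scale s) (ext_space s) p q (S_ext v)"
proof -
  obtain u1 u2 where u: "Vector_Spaces.linear s s u1" "Vector_Spaces.linear s s u2"
    "\<And>x. v x = u1 x - u2 x" "\<And>x. poly_endo s p u1 x = 0" "\<And>x. poly_endo s q u2 x = 0"
    using diff unfolding pq_difference_def endo_on_UNIV_iff[OF s] by auto
  have alt: "b_alternating (ext_scale s) (ext_space s) S_form (h_ext u)"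
    if "Vector_Spaces.linear s s u" for u
    using symplectic_pair_S_ext[OF s that] by (simp add: symplectic_pair_def S_ext_def)
  have zero: "poly_endo (ext_scale s) r (h_ext u) w = 0"
    if u: "\<And>x. poly_endo s r u x = 0" and "w \<in> ext_space s" for r u w
  proof -
    obtain x \<phi> where w: "w = (x, \<phi>)" "\<phi> \<in> dual_space s" using \<open>w \<in> ext_space s\<close> by (auto simp: ext_space_def)
    interpret \<phi>: Vector_Spaces.linear s "(*)" \<phi> using w(2) by (simp add: dual_space_def)
    show ?thesis
      by (simp add: w(1) poly_endo_h_ext[OF w(2) s] u zero_prod_def zero_fun_def \<phi>.zero)
  qed
  have "h_ext v w = h_ext u1 w - h_ext u2 w" if "w \<in> ext_space s" for w
  proof -
    obtain x \<phi> where w: "w = (x, \<phi>)" "\<phi> \<in> dual_space s" using \<open>w \<in> ext_space s\<close> by (auto simp: ext_space_def)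
    interpret \<phi>: Vector_Spaces.linear s "(*)" \<phi> using w(2) by (simp add: dual_space_def)
    show ?thesis by (simp add: w(1) h_ext_def u(3) fun_eq_iff \<phi>.diff)
  qed
  then show ?thesis
    using symplectic_pair_S_ext[OF s v] alt[OF u(1)] alt[OF u(2)] zero[OF u(4)] zero[OF u(5)]
    unfolding symplectic_pq_difference_def S_ext_def case_prod_conv by blast
qed

section \<open>The four conditions are equivalent\<close>

lemma monic_quadratic_split:
  assumes "Polynomial.degree p = 2" "Polynomial.lead_coeff p = 1" "splits p" "rsquarefree p"
  obtains a1 a2 where "p = [:- a1, 1:] * [:- a2, 1:]" "a1 \<noteq> a2" "poly_tr p = a1 + a2"
    "Root p = {to_ac a1, to_ac a2}"
proof -
  obtain as where as: "p = (\<Prod>a\<leftarrow>as. [:- a, 1:])"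
    using assms(2,3) unfolding splits_def by auto
  have "length as = 2" using assms(1) degree_linear_factors[of uminus as] as by simp
  then obtain a1 a2 where "as = [a1, a2]"
    by (auto simp: numeral_2_eq_2 length_Suc_conv)
  then have p: "p = [:- a1, 1:] * [:- a2, 1:]" using as by simp
  have "a1 \<noteq> a2"
  proof
    assume "a1 = a2"
    then have "[:- a1, 1:] ^ 2 dvd p" using p by (simp add: power2_eq_square del: mult_pCons_left)
    then have "2 \<le> Polynomial.order a1 p"
      using assms(4) by (subst (asm) order_divides) (auto simp: rsquarefree_def)
    moreover have "Polynomial.order a1 p = 0 \<or> Polynomial.order a1 p = 1"
      using assms(4) by (simp add: rsquarefree_def)
    ultimately show False by auto
  qed
  moreover have "poly_tr p = a1 + a2" by (simp add: poly_tr_def p assms(1)[unfolded p])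
  moreover have root: "to_ac x \<in> Root p \<longleftrightarrow> x = a1 \<or> x = a2" for x
  proof -
    interpret to_ac: field_hom to_ac by unfold_locales auto
    interpret m: map_poly_inj_comm_ring_hom to_ac by unfold_locales
    have "to_ac x \<in> Root p \<longleftrightarrow> poly p x = 0" by (simp add: Root_def)
    also have "poly p x = (x - a1) * (x - a2)" unfolding p poly_mult by simp
    finally show ?thesis by simp
  qed
  moreover have "Root p = {to_ac a1, to_ac a2}"
    using root Root_subset_if_splits[OF assms(3)] assms(2) by force
  ultimately show thesis using p that by blast
qed

theorem theorem4p4:
  fixes scale :: "'f::field \<Rightarrow> 'v::ab_group_add \<Rightarrow> 'v"
    and Basis :: "'v set"
    and p q :: "'f poly"
    and \<delta> :: 'f
    and v :: "'v \<Rightarrow> 'v"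
  assumes "finite_dimensional_vector_space scale Basis"
    and "Polynomial.degree p = 2" "Polynomial.lead_coeff p = 1"
    and "Polynomial.degree q = 2" "Polynomial.lead_coeff q = 1"
    and "\<delta> = poly_tr p - poly_tr q"
    and "splits p" "rsquarefree p"
    and "splits q" "rsquarefree q"
    and "Vector_Spaces.linear scale scale v"
    and "pq_exceptional scale p q v"
  shows
    "(symplectic_pq_difference (ext_scale scale) (ext_space scale) p q (S_ext v) \<longleftrightarrow>
      pq_difference (ext_scale scale) (ext_space scale) p q (h_ext v)) \<and>
     (pq_difference (ext_scale scale) (ext_space scale) p q (h_ext v) \<longleftrightarrow>
      pq_difference scale UNIV p q v) \<and>
     (pq_difference scale UNIV p q v \<longleftrightarrow>
      (\<forall>x::'f. to_ac x \<in> Root_diff p q \<and> x \<noteq> \<delta> - x \<longrightarrow>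
         intertwined 1 (nk scale v x) (nk scale v (\<delta> - x))))"
proof -
  interpret endomorphism scale Basis v
    using assms(1,11) by (simp add: endomorphism_def)
  obtain a1 a2 where a: "p = [:- a1, 1:] * [:- a2, 1:]" "a1 \<noteq> a2" "poly_tr p = a1 + a2"
    "Root p = {to_ac a1, to_ac a2}"
    by (rule monic_quadratic_split[OF assms(2,3,7,8)]) (rule that)
  obtain b1 b2 where b: "q = [:- b1, 1:] * [:- b2, 1:]" "b1 \<noteq> b2" "poly_tr q = b1 + b2"
    "Root q = {to_ac b1, to_ac b2}"
    by (rule monic_quadratic_split[OF assms(4,5,9,10)]) (rule that)
  have a': "p = [:- a2, 1:] * [:- a1, 1:]" and b': "q = [:- b2, 1:] * [:- b1, 1:]"
    by (simp_all only: a(1) b(1) mult.commute)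
  have "Root_diff p q = {to_ac (a1 - b1), to_ac (a2 - b2), to_ac (a1 - b2), to_ac (a2 - b1)}"
    by (auto simp: Root_diff_def a(4) b(4))
  then have Root_diff: "to_ac x \<in> Root_diff p q \<longleftrightarrow> x \<in> {a1 - b1, a2 - b2, a1 - b2, a2 - b1}" for x
    by (simp only: insert_iff empty_iff to_ac_eq_iff)
  \<comment> \<open>The traces are the sums of the roots, so subtraction from \<delta> exchanges the
    members of each pair.\<close>
  have \<delta>: "\<delta> - (a1 - b1) = a2 - b2" "\<delta> - (a2 - b2) = a1 - b1"
    "\<delta> - (a1 - b2) = a2 - b1" "\<delta> - (a2 - b1) = a1 - b2"
    by (simp_all add: assms(6) a(3) b(3))
  \<comment> \<open>The implications are proved in the cycle (i), (ii), (iv), (iii), (i).\<close>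
  have "pq_difference (ext_scale scale) (ext_space scale) p q (h_ext v)"
    if "symplectic_pq_difference (ext_scale scale) (ext_space scale) p q (S_ext v)"
    using that
    by (auto simp: symplectic_pq_difference_def S_ext_def pq_difference_def b_alternating_def)
  moreover have "intertwined 1 (nk scale v x) (nk scale v (\<delta> - x))"
    if diff: "pq_difference (ext_scale scale) (ext_space scale) p q (h_ext v)"
      and x: "to_ac x \<in> Root_diff p q" "x \<noteq> \<delta> - x" for x
  proof -
    \<comment> \<open>The lemma treats the difference of the first root of \<open>p\<close> and the
      first root of \<open>q\<close>; exchanging the roots of \<open>p\<close>, of \<open>q\<close>
      or of both brings the other three differences into this form.\<close>
    note int = intertwined_if_h_ext_difference[OF diff]
    consider "x = a1 - b1" | "x = a2 - b2" | "x = a1 - b2" | "x = a2 - b1"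
      using x(1) by (auto simp: Root_diff)
    then show ?thesis
    proof cases
      case 1
      then show ?thesis using int[OF a(1,2) b(1,2)] x(2) by (simp only: \<delta> simp_thms)
    next
      case 2
      then show ?thesis using int[OF a' a(2)[symmetric] b' b(2)[symmetric]] x(2) by (simp only: \<delta> simp_thms)
    next
      case 3
      then show ?thesis using int[OF a(1,2) b' b(2)[symmetric]] x(2) by (simp only: \<delta> simp_thms)
    next
      case 4
      then show ?thesis using int[OF a' a(2)[symmetric] b(1,2)] x(2) by (simp only: \<delta> simp_thms)
    qed
  qed
  moreover have "pq_difference scale UNIV p q v"
    if int: "\<forall>x. to_ac x \<in> Root_diff p q \<and> x \<noteq> \<delta> - x \<longrightarrow>
      intertwined 1 (nk scale v x) (nk scale v (\<delta> - x))"
  proof -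
    have "p \<noteq> 0" "q \<noteq> 0" using assms(3,5) by auto
    obtain as where as: "\<And>a. a \<in> set as \<Longrightarrow> to_ac a \<in> Root_diff p q"
      "\<And>w. act (\<Prod>a\<leftarrow>as. [:- a, 1:]) w = 0"
      by (rule exceptional_annihilated[OF assms(12,7) \<open>p \<noteq> 0\<close> assms(9) \<open>q \<noteq> 0\<close>]) (rule that)
    show ?thesis
    proof (rule difference_if_intertwined[OF as(2) _ a(1,2) b(1,2)])
      show "set as \<subseteq> {a1 - b1, a2 - b2, a1 - b2, a2 - b1}"
        using as(1) Root_diff by blast
      show "intertwined 1 (nk scale v (a1 - b1)) (nk scale v (a2 - b2))" if "a1 - b1 \<noteq> a2 - b2"
        using int[rule_format, of "a1 - b1"] that unfolding Root_diff \<delta> by simp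
      show "intertwined 1 (nk scale v (a1 - b2)) (nk scale v (a2 - b1))" if "a1 - b2 \<noteq> a2 - b1"
        using int[rule_format, of "a1 - b2"] that unfolding Root_diff \<delta> by simp
    qed
  qed
  moreover have "symplectic_pq_difference (ext_scale scale) (ext_space scale) p q (S_ext v)"
    if "pq_difference scale UNIV p q v"
    using vector_space_axioms assms(11) that by (rule symplectic_difference_if_difference)
  ultimately show ?thesis by blast
qed

end
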